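(* Let $m>0$. Schwarzschild (outer) spacetime $M^{a=0}=\mathbb{R}\times\{x\in\mathbb{R}^3: r>2m\}$, endowed with the metric $$ds^2=-\Big(1-\frac{2m}{r}\Big)dt^2+\frac{r}{r-2m}\,dr^2+r^2\big(d\theta^2+\sin^2\theta\,d\varphi^2\big),$$ is geodesically connected.
   Context: $(r,\theta,\varphi)$ are the usual spherical coordinates on $\mathbb{R}^3$ and $t$ is the coordinate on the factor $\mathbb{R}$. (This is the Kerr spacetime of mass $m$ in the limit case of zero angular momentum, $a=0$.) A spacetime is geodesically connected if any two of its points can be joined by a geodesic (of any causal character) contained in it. *)

theory Defs
  imports "HOL-Analysis.Analysis"
begin

section \<open>Geodesics of a metric tensor on an open subset of a Euclidean space\<close>

text \<open>
  A metric tensor on (an open subset of) the vector space \<open>'a\<close> is given as \<open>g p v w\<close>, where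
  \<open>p\<close> is the base point and \<open>v\<close>, \<open>w\<close> are tangent vectors at \<open>p\<close>. It may be indefinite.
\<close>

type_synonym 'a metric_tensor = "'a \<Rightarrow> 'a \<Rightarrow> 'a \<Rightarrow> real"

text \<open>The derivative at \<open>p\<close> in direction \<open>u\<close> of the metric coefficient \<open>g(v, w)\<close>, for constant
  vector fields \<open>v\<close> and \<open>w\<close>.\<close>

definition metric_deriv :: "'a::euclidean_space metric_tensor \<Rightarrow> 'a \<Rightarrow> 'a \<Rightarrow> 'a \<Rightarrow> 'a \<Rightarrow> real" where
  "metric_deriv g p u v w = frechet_derivative (\<lambda>y. g y v w) (at p) u"

text \<open>
  The vector with components \<open>\<Gamma>\<^sup>k\<^sub>i\<^sub>j u\<^sup>i v\<^sup>j\<close>, that is, the Levi-Civita derivative at \<open>p\<close> of the constant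
  vector field \<open>v\<close> in direction \<open>u\<close>, given by the Koszul formula (Lie brackets of constant fields
  vanish). It is uniquely determined wherever \<open>g\<close> is differentiable and nondegenerate; see
  \<open>schwarzschild_christoffel_ex1\<close> below for the metric of interest.
\<close>

definition christoffel :: "'a::euclidean_space metric_tensor \<Rightarrow> 'a \<Rightarrow> 'a \<Rightarrow> 'a \<Rightarrow> 'a" where
  "christoffel g p u v = (THE w. \<forall>z. g p w z =
     (metric_deriv g p u v z + metric_deriv g p v u z - metric_deriv g p z u v) / 2)"

text \<open>Affinely parametrised geodesics of any causal character; at the end points of \<open>I\<close> the
  derivatives are one-sided.\<close>

definition geodesic_on ::
  "'a::euclidean_space metric_tensor \<Rightarrow> 'a set \<Rightarrow> real set \<Rightarrow> (real \<Rightarrow> 'a) \<Rightarrow> bool" where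
  "geodesic_on g M I \<gamma> \<longleftrightarrow>
     (\<forall>s\<in>I. \<gamma> s \<in> M) \<and>
     (\<exists>\<gamma>'. \<forall>s\<in>I. (\<gamma> has_vector_derivative \<gamma>' s) (at s within I) \<and>
        (\<gamma>' has_vector_derivative - christoffel g (\<gamma> s) (\<gamma>' s) (\<gamma>' s)) (at s within I))"

definition geodesically_connected :: "'a::euclidean_space metric_tensor \<Rightarrow> 'a set \<Rightarrow> bool" where
  "geodesically_connected g M \<longleftrightarrow>
     (\<forall>p\<in>M. \<forall>q\<in>M. \<exists>\<gamma>. geodesic_on g M {0..1} \<gamma> \<and> \<gamma> 0 = p \<and> \<gamma> 1 = q)"


section \<open>Outer Schwarzschild spacetime\<close>

definition schwarzschild_spacetime :: "real \<Rightarrow> (real \<times> (real ^ 3)) set" where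
  "schwarzschild_spacetime m = UNIV \<times> {x. norm x > 2 * m}"

text \<open>
  Spherical coordinates do not cover the polar axis, so the metric is written in the global
  coordinates \<open>(t, x)\<close>, where \<open>r = norm x\<close>, \<open>dr(v) = (x \<bullet> v) / r\<close>, and
  \<open>r\<^sup>2 (d\<theta>\<^sup>2 + sin\<^sup>2 \<theta> d\<phi>\<^sup>2) = |dx|\<^sup>2 - dr\<^sup>2\<close>. The expression in spherical coordinates is
  \<open>schwarzschild_metric_spherical\<close> below.
\<close>

definition schwarzschild_metric :: "real \<Rightarrow> (real \<times> (real ^ 3)) metric_tensor" where
  "schwarzschild_metric m p v w =
     (let x = snd p; r = norm x; dr = (\<lambda>u :: real \<times> (real ^ 3). (x \<bullet> snd u) / r)
      in - (1 - 2 * m / r) * (fst v * fst w) + r / (r - 2 * m) * (dr v * dr w)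
         + (snd v \<bullet> snd w - dr v * dr w))"

definition spherical :: "real \<Rightarrow> real \<Rightarrow> real \<Rightarrow> real ^ 3" where
  "spherical r \<theta> \<phi> = vector [r * sin \<theta> * cos \<phi>, r * sin \<theta> * sin \<phi>, r * cos \<theta>]"

lemma norm_spherical: "r \<ge> 0 \<Longrightarrow> norm (spherical r \<theta> \<phi>) = r"
proof -
  assume r: "r \<ge> 0"
  have tp: "(sin \<theta>)\<^sup>2 + (cos \<theta>)\<^sup>2 = 1" "(sin \<phi>)\<^sup>2 + (cos \<phi>)\<^sup>2 = 1"
    by simp_all
  have "(r * sin \<theta> * cos \<phi>)\<^sup>2 + (r * sin \<theta> * sin \<phi>)\<^sup>2 + (r * cos \<theta>)\<^sup>2 = r\<^sup>2"
    using tp by algebra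
  then show ?thesis using r
    by (simp add: norm_vec_def L2_set_def sum_3 spherical_def)
qed

lemma schwarzschild_metric_spherical:
  fixes t r \<theta> \<phi> :: "real \<Rightarrow> real"
  assumes t: "(t has_real_derivative t') (at s)" and r: "(r has_real_derivative r') (at s)"
    and \<theta>: "(\<theta> has_real_derivative \<theta>') (at s)" and \<phi>: "(\<phi> has_real_derivative \<phi>') (at s)"
    and pos: "r s > 0"
    and V: "((\<lambda>s. (t s, spherical (r s) (\<theta> s) (\<phi> s))) has_vector_derivative V) (at s)"
  shows "schwarzschild_metric m (t s, spherical (r s) (\<theta> s) (\<phi> s)) V V =
    - (1 - 2 * m / r s) * t'\<^sup>2 + r s / (r s - 2 * m) * r'\<^sup>2
    + (r s)\<^sup>2 * (\<theta>'\<^sup>2 + (sin (\<theta> s))\<^sup>2 * \<phi>'\<^sup>2)"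
proof -
  let ?x = "spherical (r s) (\<theta> s) (\<phi> s)"
  have V1: "fst V = t'"
  proof -
    have "(t has_vector_derivative fst V) (at s)"
      using bounded_linear.has_vector_derivative[OF bounded_linear_fst V] by simp
    then show ?thesis
      using t vector_derivative_unique_at
      by (metis has_real_derivative_iff_has_vector_derivative)
  qed
  have comp: "((\<lambda>s. spherical (r s) (\<theta> s) (\<phi> s) $ i) has_real_derivative snd V $ i) (at s)" for i
    using bounded_linear.has_vector_derivative
        [OF bounded_linear_compose[OF bounded_linear_vec_nth[of i] bounded_linear_snd] V]
    by (simp add: has_real_derivative_iff_has_vector_derivative)
  have c1: "snd V $ 1 = r' * sin (\<theta> s) * cos (\<phi> s) + r s * cos (\<theta> s) * \<theta>' * cos (\<phi> s)
      - r s * sin (\<theta> s) * sin (\<phi> s) * \<phi>'"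
    using comp[of 1] unfolding spherical_def vector_3
    by (rule DERIV_unique) (auto intro!: derivative_eq_intros r \<theta> \<phi> simp: algebra_simps)
  have c2: "snd V $ 2 = r' * sin (\<theta> s) * sin (\<phi> s) + r s * cos (\<theta> s) * \<theta>' * sin (\<phi> s)
      + r s * sin (\<theta> s) * cos (\<phi> s) * \<phi>'"
    using comp[of 2] unfolding spherical_def vector_3
    by (rule DERIV_unique) (auto intro!: derivative_eq_intros r \<theta> \<phi> simp: algebra_simps)
  have c3: "snd V $ 3 = r' * cos (\<theta> s) - r s * sin (\<theta> s) * \<theta>'"
    using comp[of 3] unfolding spherical_def vector_3
    by (rule DERIV_unique) (auto intro!: derivative_eq_intros r \<theta> \<phi> simp: algebra_simps)
  have tp: "(sin (\<theta> s))\<^sup>2 + (cos (\<theta> s))\<^sup>2 = 1" "(sin (\<phi> s))\<^sup>2 + (cos (\<phi> s))\<^sup>2 = 1"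
    by simp_all
  have "?x \<bullet> snd V = r s * r'"
    unfolding inner_vec_def sum_3 c1 c2 c3 spherical_def vector_3 inner_real_def
    using tp by algebra
  then have dr: "?x \<bullet> snd V / norm ?x = r'"
    using pos norm_spherical by simp
  have "snd V \<bullet> snd V = r'\<^sup>2 + (r s)\<^sup>2 * (\<theta>'\<^sup>2 + (sin (\<theta> s))\<^sup>2 * \<phi>'\<^sup>2)"
    unfolding inner_vec_def sum_3 c1 c2 c3 inner_real_def
    using tp by algebra
  with V1 show ?thesis
    unfolding schwarzschild_metric_def Let_def fst_conv snd_conv dr
    using pos by (simp add: norm_spherical power2_eq_square)
qed

lemma schwarzschild_metric_nondegenerate:
  assumes m: "m > 0" and p: "p \<in> schwarzschild_spacetime m"
    and w: "\<And>z. schwarzschild_metric m p w z = 0"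
  shows "w = 0"
proof -
  define x r where "x = snd p" and "r = norm x"
  have r: "r > 2 * m" using p by (auto simp: schwarzschild_spacetime_def x_def r_def)
  have x: "x \<bullet> x = r\<^sup>2" by (simp add: r_def dot_square_norm)
  have "fst w = 0"
    using w[of "(1, 0)"] r m by (auto simp: schwarzschild_metric_def Let_def x_def r_def)
  moreover have d: "x \<bullet> snd w = 0"
  proof -
    have "x \<bullet> x / r = r" using x r m by (simp add: power2_eq_square)
    moreover have "snd w \<bullet> x = x \<bullet> snd w" by (rule inner_commute)
    ultimately show ?thesis
      using w[of "(0, x)"] r m
      unfolding schwarzschild_metric_def Let_def fst_conv snd_conv x_def[symmetric] r_def[symmetric]
      by auto
  qed
  moreover have "snd w = 0"
    using w[of "(0, snd w)"] d
    unfolding schwarzschild_metric_def Let_def fst_conv snd_conv x_def[symmetric] r_def[symmetric]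
    by simp
  ultimately show ?thesis by (simp add: prod_eq_iff)
qed

lemma schwarzschild_metric_differentiable:
  assumes m: "m > 0" and p: "p \<in> schwarzschild_spacetime m"
  shows "(\<lambda>y. schwarzschild_metric m y v w) differentiable (at p)"
proof -
  have nz: "snd p \<noteq> 0" "norm (snd p) \<noteq> 2 * m"
    using p m by (auto simp: schwarzschild_spacetime_def)
  have s: "(\<lambda>y :: real \<times> (real ^ 3). snd y) differentiable (at p)"
    by (simp add: bounded_linear_imp_differentiable bounded_linear_snd)
  have n: "(\<lambda>y :: real \<times> (real ^ 3). norm (snd y)) differentiable (at p)"
    using nz differentiable_chain_at[OF s, of norm] differentiable_norm_at[of "snd p"]
    by (simp add: o_def)
  show ?thesis
    unfolding schwarzschild_metric_def Let_def
    using nz by (intro differentiable_add differentiable_diff differentiable_mult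
        differentiable_divide differentiable_minus differentiable_inner differentiable_const s n) auto
qed

lemma schwarzschild_christoffel_ex1:
  assumes m: "m > 0" and p: "p \<in> schwarzschild_spacetime m"
  defines "g \<equiv> schwarzschild_metric m"
  shows "\<exists>!w. \<forall>z. g p w z =
     (metric_deriv g p u v z + metric_deriv g p v u z - metric_deriv g p z u v) / 2"
proof -
  define L where "L z = (metric_deriv g p u v z + metric_deriv g p v u z - metric_deriv g p z u v) / 2" for z
  have diff: "(\<lambda>y. g y a b) differentiable (at p)" for a b
    using schwarzschild_metric_differentiable[OF m p] by (simp add: g_def)
  have lin2: "linear (g y a)" for y a
    unfolding g_def schwarzschild_metric_def Let_def
    by (intro linearI) (auto simp: algebra_simps inner_add_right add_divide_distrib)
  have lin1: "linear (\<lambda>a. g y a b)" for y b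
    unfolding g_def schwarzschild_metric_def Let_def
    by (intro linearI) (auto simp: algebra_simps inner_add_right inner_add_left add_divide_distrib)
  have D2: "linear (metric_deriv g p a b)" for a b
  proof (rule linearI)
    fix y z and c :: real
    note h = diff[of b, unfolded frechet_derivative_works]
    show "metric_deriv g p a b (y + z) = metric_deriv g p a b y + metric_deriv g p a b z"
      unfolding metric_deriv_def linear_add[OF lin2]
        frechet_derivative_at[OF has_derivative_add[OF h[of y] h[of z]], symmetric] by (rule refl)
    show "metric_deriv g p a b (c *\<^sub>R y) = c *\<^sub>R metric_deriv g p a b y"
      unfolding metric_deriv_def linear_scale[OF lin2]
        frechet_derivative_at[OF has_derivative_scaleR_right[OF h[of y], of c], symmetric] by (rule refl)
  qed
  have D0: "linear (\<lambda>z. metric_deriv g p z a b)" for a b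
    unfolding metric_deriv_def by (rule linear_frechet_derivative[OF diff])
  have L: "linear L"
    unfolding L_def
    by (intro linearI)
      (auto simp: linear_add[OF D2] linear_add[OF D0] linear_scale[OF D2] linear_scale[OF D0]
        algebra_simps add_divide_distrib diff_divide_distrib)
  define A where "A w = (\<Sum>b\<in>Basis. g p w b *\<^sub>R b)" for w
  have A: "A w \<bullet> z = g p w z" for w z
  proof -
    have "g p w z = g p w (\<Sum>b\<in>Basis. (z \<bullet> b) *\<^sub>R b)" by (simp only: euclidean_representation)
    also have "\<dots> = (\<Sum>b\<in>Basis. (z \<bullet> b) * g p w b)"
      by (simp only: linear_sum[OF lin2] linear_scale[OF lin2] real_scaleR_def)
    finally show ?thesis by (simp only: A_def inner_sum_left inner_scaleR_left)
        (simp only: inner_commute mult.commute)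
  qed
  have linA: "linear A"
    unfolding A_def
    by (intro linearI) (simp_all add: linear_add[OF lin1] linear_scale[OF lin1] scaleR_add_left
        sum.distrib scaleR_sum_right)
  have injA: "inj A"
    unfolding linear_injective_0[OF linA]
    using A schwarzschild_metric_nondegenerate[OF m p] by (metis g_def inner_zero_left)
  obtain w where w: "A w = (\<Sum>b\<in>Basis. L b *\<^sub>R b)"
    using linear_injective_imp_surjective[OF linA injA] by (metis surjD)
  have "g p w z = L z" for z
  proof -
    have "L z = L (\<Sum>b\<in>Basis. (z \<bullet> b) *\<^sub>R b)" by (simp only: euclidean_representation)
    also have "\<dots> = (\<Sum>b\<in>Basis. (z \<bullet> b) * L b)"
      by (simp only: linear_sum[OF L] linear_scale[OF L] real_scaleR_def)
    also have "\<dots> = A w \<bullet> z"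
      by (simp only: w inner_sum_left inner_scaleR_left) (simp only: inner_commute mult.commute)
    finally show ?thesis by (simp add: A)
  qed
  moreover have "w' = w''" if "\<And>z. g p w' z = L z" "\<And>z. g p w'' z = L z" for w' w''
    using injA that by (metis A injD vector_eq_rdot)
  ultimately show ?thesis
    unfolding L_def[symmetric] by blast
qed

end

(*
  With R = 2m, write a spatial orbit in a plane through the origin as u = R/r, a function of a
  parameter x in [0,1] proportional to the polar angle, phi = w x. The geodesic equations become
  u'' = A - w^2 u + (3/2) w^2 u^2, with conserved energy E^2 = u'^2 + (1 - u)(2A + w^2 u^2); the
  elapsed coordinate time is R E times the integral of 1/(u^2 (1 - u)). The case w = 0 is that of
  radial geodesics. For 0 <= w <= pi and every initial slope p there is exactly one A = A(p) for which
  the orbit starting at R/r0 ends at R/r1 (shooting, by monotonicity in A). As p grows, the orbit moves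
  from one touching u = 0 (infinity), where E^2 = 2A > 0 and the elapsed time diverges, to one touching
  u = 1 (the horizon), where 2A + w^2 < 0; shortly before the latter the conserved quantity E^2
  is negative. By the intermediate value
  theorem every elapsed time is attained in between, by an orbit with 0 < u < 1 and E^2 >= 0.
*)
theory Submission
  imports Defs
begin

section \<open>One-variable calculus\<close>

text \<open>The equation for u is Binet's equation, and the geodesic built from an orbit has
  g(\<gamma>', \<gamma>') equal to a negative multiple of A. Its causal character is therefore not
  prescribed but comes out of the shooting. Solutions of the true equation may leave 0 <= u <= 1 or
  blow up. The quadratic term is frozen outside this range, so that an orbit exists for all p and A
  and depends on them in a Lipschitz way; only orbits that stay inside are physical. The angle bound
  w <= pi enters twice. It makes the fundamental solution \<open>sn\<close> nonnegative on [0,1], so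
  that the Duhamel operator preserves order and the end value increases with A. It also prevents an
  orbit with A < 0 from dipping below 0 and coming back, so that the orbit touching the horizon
  cannot touch infinity as well: the two extreme slopes are distinct. Between them E^2 changes sign,
  so the intermediate value theorem is applied to E^2 times the square of the time integral; the
  sign of E is chosen at the end and decides the direction of time.\<close>

lemma within_deriv_nonpos_imp_le:
  fixes f f' :: "real \<Rightarrow> real"
  assumes "a \<le> b"
    and d: "\<And>x. x \<in> {a..b} \<Longrightarrow> (f has_real_derivative f' x) (at x within {a..b})"
    and n: "\<And>x. x \<in> {a..b} \<Longrightarrow> f' x \<le> 0"
  shows "f b \<le> f a"
proof (cases "a = b")
  case False
  then have "a < b" using assms by simp
  then obtain x where x: "x \<in> {a<..<b}" "f b - f a = f' x * (b - a)"
    using mvt_simple[of a b f "\<lambda>x. (*) (f' x)"] d by (auto simp: has_field_derivative_def)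
  have "f' x * (b - a) \<le> 0" using x(1) n[of x] \<open>a < b\<close> by (simp add: mult_nonpos_nonneg)
  then show ?thesis using x(2) by simp
qed simp

text \<open>The bound \<open>a + K * integral {0..x} f\<close>, multiplied by exp (- K x), has
  nonpositive derivative.\<close>

lemma gronwall:
  fixes f :: "real \<Rightarrow> real"
  assumes f: "continuous_on {0..1} f" and K: "K \<ge> 0"
    and le: "\<And>x. x \<in> {0..1} \<Longrightarrow> f x \<le> a + K * integral {0..x} f"
    and x: "x \<in> {0..1}"
  shows "f x \<le> a * exp (K * x)"
proof -
  define Y where "Y x = (a + K * integral {0..x} f) * exp (- K * x)" for x
  have "Y x \<le> Y 0"
  proof (rule within_deriv_nonpos_imp_le[where f = Y
      and f' = "\<lambda>y. K * (f y - (a + K * integral {0..y} f)) * exp (- K * y)"])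
    fix y assume y: "y \<in> {0..x}"
    have "((\<lambda>y. integral {0..y} f) has_real_derivative f y) (at y within {0..x})"
      using x y by (intro integral_has_real_derivative continuous_on_subset[OF f]) auto
    then show "(Y has_real_derivative K * (f y - (a + K * integral {0..y} f)) * exp (- K * y))
        (at y within {0..x})"
      unfolding Y_def by (auto intro!: derivative_eq_intros simp: algebra_simps)
    show "K * (f y - (a + K * integral {0..y} f)) * exp (- K * y) \<le> 0"
      using le[of y] x y K by (intro mult_nonpos_nonneg mult_nonneg_nonpos) auto
  qed (use x in auto)
  then have "(a + K * integral {0..x} f) * exp (- (K * x)) * exp (K * x) \<le> a * exp (K * x)"
    by (intro mult_right_mono) (auto simp: Y_def)
  then have "a + K * integral {0..x} f \<le> a * exp (K * x)"
    by (simp add: mult.assoc flip: exp_add)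
  then show ?thesis using le[OF x] by simp
qed

text \<open>The operator f'' - k^2 f factors as (D - k)(D + k), so two monotonicity arguments of
  first order suffice, one for f' + k f and one for f. Below it acts as a one-sided uniqueness
  principle at points of tangency.\<close>

lemma second_order_comparison:
  fixes f f' f'' :: "real \<Rightarrow> real"
  assumes "a \<le> b"
    and f: "\<And>x. x \<in> {a..b} \<Longrightarrow> (f has_real_derivative f' x) (at x within {a..b})"
    and f': "\<And>x. x \<in> {a..b} \<Longrightarrow> (f' has_real_derivative f'' x) (at x within {a..b})"
    and le: "\<And>x. x \<in> {a..b} \<Longrightarrow> f'' x \<le> k\<^sup>2 * f x"
    and init: "f a = 0" "f' a = 0"
  shows "f b \<le> 0"
proof -
  define h where "h x = (f' x + k * f x) * exp (- k * x)" for x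
  have h: "h x \<le> 0" if x: "x \<in> {a..b}" for x
  proof -
    have "h x \<le> h a"
    proof (rule within_deriv_nonpos_imp_le[where f = h
        and f' = "\<lambda>y. (f'' y - k\<^sup>2 * f y) * exp (- k * y)"])
      fix y assume y: "y \<in> {a..x}"
      then have ys: "y \<in> {a..b}" "{a..x} \<subseteq> {a..b}" using x by auto
      note D = DERIV_subset[OF f[OF ys(1)] ys(2)] DERIV_subset[OF f'[OF ys(1)] ys(2)]
      show "(h has_real_derivative (f'' y - k\<^sup>2 * f y) * exp (- k * y)) (at y within {a..x})"
        unfolding h_def by (auto intro!: derivative_eq_intros D simp: algebra_simps power2_eq_square)
      show "(f'' y - k\<^sup>2 * f y) * exp (- k * y) \<le> 0"
        using le[OF ys(1)] by (intro mult_nonpos_nonneg) auto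
    qed (use x in auto)
    then show ?thesis by (simp add: h_def init)
  qed
  define j where "j x = f x * exp (k * x)" for x
  have "j b \<le> j a"
  proof (rule within_deriv_nonpos_imp_le[where f = j
      and f' = "\<lambda>y. (f' y + k * f y) * exp (k * y)"])
    fix y assume y: "y \<in> {a..b}"
    show "(j has_real_derivative (f' y + k * f y) * exp (k * y)) (at y within {a..b})"
      unfolding j_def by (auto intro!: derivative_eq_intros f[OF y] simp: algebra_simps)
    show "(f' y + k * f y) * exp (k * y) \<le> 0"
      using h[OF y] by (intro mult_nonpos_nonneg) (auto simp: h_def mult_le_0_iff)
  qed fact
  then show ?thesis by (simp add: j_def init mult_le_0_iff)
qed

lemma deriv_eq_0_at_max:
  fixes f :: "real \<Rightarrow> real"
  assumes "(f has_real_derivative f') (at x within {a..b})" "a < x" "x < b"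
    and "\<And>y. y \<in> {a..b} \<Longrightarrow> f y \<le> f x"
  shows "f' = 0"
proof (rule DERIV_local_max)
  show "(f has_real_derivative f') (at x)"
    using assms(1-3) by (simp add: at_within_Icc_at)
  show "0 < min (x - a) (b - x)" using assms by simp
  show "\<forall>y. \<bar>x - y\<bar> < min (x - a) (b - x) \<longrightarrow> f y \<le> f x"
    using assms(4) by (auto simp: abs_less_iff)
qed

lemma deriv_eq_0_at_min:
  fixes f :: "real \<Rightarrow> real"
  assumes "(f has_real_derivative f') (at x within {a..b})" "a < x" "x < b"
    and "\<And>y. y \<in> {a..b} \<Longrightarrow> f x \<le> f y"
  shows "f' = 0"
  using deriv_eq_0_at_max[OF DERIV_minus[OF assms(1)] assms(2,3)] assms(4) by simp

text \<open>The difference of the two sides is convex and vanishes at 0 and 1. The error term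
  vanishes there too, so that it can later be weighed against a term of the same size near the end
  points.\<close>

lemma le_chord_plus_parabola:
  fixes f f' f'' :: "real \<Rightarrow> real"
  assumes f: "\<And>x. x \<in> {0..1} \<Longrightarrow> (f has_real_derivative f' x) (at x within {0..1})"
    and f': "\<And>x. x \<in> {0..1} \<Longrightarrow> (f' has_real_derivative f'' x) (at x within {0..1})"
    and B: "\<And>x. x \<in> {0..1} \<Longrightarrow> - B \<le> f'' x" and x: "x \<in> {0..1}"
  shows "f x \<le> (1 - x) * f 0 + x * f 1 + B / 2 * (x * (1 - x))"
proof -
  define h where "h x = f x - ((1 - x) * f 0 + x * f 1 + B / 2 * (x * (1 - x)))" for x
  define h' where "h' x = f' x - (f 1 - f 0 + B / 2 * (1 - 2 * x))" for x
  have h: "(h has_real_derivative h' x) (at x within {0..1})" if "x \<in> {0..1}" for x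
    unfolding h_def[abs_def] h'_def
    by (auto intro!: derivative_eq_intros f[OF that] simp: field_simps)
  have h': "(h' has_real_derivative f'' x + B) (at x within {0..1})" if "x \<in> {0..1}" for x
    unfolding h'_def[abs_def] by (auto intro!: derivative_eq_intros f'[OF that])
  have "continuous_on {0..1} h"
    using h by (rule DERIV_continuous_on)
  then obtain z where z: "z \<in> {0..1}" "\<And>y. y \<in> {0..1} \<Longrightarrow> h y \<le> h z"
    using continuous_attains_sup[of "{0..1}" h] by auto
  have h01: "h 0 = 0" "h 1 = 0" by (auto simp: h_def)
  \<comment> \<open>At an interior maximum \<open>z\<close> the derivative vanishes, and the
    comparison with k = 0 on [z,1] gives h z <= h 1 = 0.\<close>
  have "h z \<le> 0"
  proof (cases "z = 0 \<or> z = 1")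
    case False
    then have z01: "0 < z" "z < 1" using z by auto
    then have "h' z = 0" using deriv_eq_0_at_max[OF h] z by blast
    moreover have s: "{z..1} \<subseteq> {0..1}" using z01 by auto
    ultimately have "h z - h 1 \<le> 0"
    proof (intro second_order_comparison[where f = "\<lambda>x. h z - h x" and f' = "\<lambda>x. - h' x" and f'' = "\<lambda>x. - (f'' x + B)"
        and k = 0 and a = z and b = 1])
      fix x assume "x \<in> {z..1}"
      then have x: "x \<in> {0..1}" using s by blast
      show "((\<lambda>x. h z - h x) has_real_derivative - h' x) (at x within {z..1})"
        by (auto intro!: derivative_eq_intros DERIV_subset[OF h[OF x] s])
      show "((\<lambda>x. - h' x) has_real_derivative - (f'' x + B)) (at x within {z..1})"
        by (intro DERIV_minus DERIV_subset[OF h'[OF x] s])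
      show "- (f'' x + B) \<le> 0\<^sup>2 * (h z - h x)" using B[OF x] by simp
    qed (use z01 in auto)
    then show ?thesis using h01 by simp
  qed (use h01 in auto)
  then have "h x \<le> 0" using z(2)[OF x] by simp
  then show ?thesis by (simp add: h_def)
qed

text \<open>Jordan's inequality, from the concavity of sin.\<close>

lemma sin_ge_two_over_pi:
  assumes "0 \<le> x" "x \<le> pi / 2"
  shows "2 / pi * x \<le> sin x"
proof -
  have "concave_on {0..pi} sin"
    by (rule f''_le0_imp_concave[where f' = cos and f'' = "\<lambda>x. - sin x"])
      (auto intro!: derivative_eq_intros sin_ge_zero)
  then have "convex_on {0..pi} (\<lambda>x. - sin x)" by (simp add: concave_on_def)
  from convex_onD[OF this, of "2 / pi * x" 0 "pi / 2"] show ?thesis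
    using assms by (simp add: field_simps)
qed

text \<open>The difference quotient of \<open>g\<close> is the reciprocal of that of
  \<open>f\<close> taken along \<open>g\<close>. The form within sets covers the end points of
  closed intervals.\<close>

lemma inverse_has_real_derivative_within:
  fixes f g :: "real \<Rightarrow> real"
  assumes f: "(f has_real_derivative D) (at (g x) within T)" and "D \<noteq> 0"
    and g: "continuous (at x within S) g" "x \<in> S"
    and fg: "\<And>y. y \<in> S \<Longrightarrow> g y \<in> T \<and> f (g y) = y"
  shows "(g has_real_derivative inverse D) (at x within S)"
proof -
  have "\<forall>\<^sub>F y in at x within S. g y \<in> T \<and> g y \<noteq> g x"
    unfolding eventually_at_filter using fg g(2) by (intro always_eventually) metis
  then have "filterlim g (at (g x) within T) (at x within S)"
    using g(1) by (simp add: filterlim_at continuous_within)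
  with f have "((\<lambda>y. (f (g y) - f (g x)) / (g y - g x)) \<longlongrightarrow> D) (at x within S)"
    unfolding has_field_derivative_iff by (rule filterlim_compose)
  then have "((\<lambda>y. inverse ((f (g y) - f (g x)) / (g y - g x))) \<longlongrightarrow> inverse D) (at x within S)"
    using \<open>D \<noteq> 0\<close> by (rule tendsto_inverse)
  moreover have "\<forall>\<^sub>F y in at x within S. inverse ((f (g y) - f (g x)) / (g y - g x)) = (g y - g x) / (y - x)"
    unfolding eventually_at_filter using fg g(2) by (intro always_eventually) simp
  ultimately show ?thesis
    unfolding has_field_derivative_iff by (rule Lim_transform_eventually)
qed

text \<open>\<open>l\<close> is the inverse of the normalised primitive of \<open>f\<close>. With f
  = 1/u^2 it will turn the angular parameter of an orbit into an affine one.\<close>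

lemma ex_reparametrization:
  fixes f :: "real \<Rightarrow> real"
  assumes f: "continuous_on {0..1} f" and pos: "\<And>x. x \<in> {0..1} \<Longrightarrow> 0 < f x"
  obtains l where "l 0 = 0" "l 1 = 1" "\<And>s. s \<in> {0..1} \<Longrightarrow> l s \<in> {0..1}"
    "\<And>s. s \<in> {0..1} \<Longrightarrow> (l has_real_derivative integral {0..1} f / f (l s)) (at s within {0..1})"
proof -
  define K where "K = integral {0..1} f"
  obtain z where z: "z \<in> {0..1}" "\<And>x. x \<in> {0..1} \<Longrightarrow> f z \<le> f x"
    using continuous_attains_inf[OF compact_Icc _ f] by fastforce
  have "integral {0..1::real} (\<lambda>x. f z) \<le> K"
    unfolding K_def by (rule integral_le) (use z f in \<open>auto intro: integrable_continuous_real\<close>)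
  then have K: "0 < K" using pos[OF z(1)] by simp
  define F where "F x = integral {0..x} f / K" for x
  have F: "(F has_real_derivative f x / K) (at x within {0..1})" if "x \<in> {0..1}" for x
    unfolding F_def[abs_def]
    by (intro DERIV_cdivide integral_has_real_derivative f that)
  have contF: "continuous_on {0..1} F" by (rule DERIV_continuous_on[OF F])
  have F01: "F 0 = 0" "F 1 = 1" using K by (auto simp: F_def K_def)
  have less: "F x < F y" if "0 \<le> x" "x < y" "y \<le> 1" for x y
  proof (rule DERIV_pos_imp_increasing_open[OF that(2)])
    fix t assume t: "x < t" "t < y"
    then have "(F has_real_derivative f t / K) (at t)"
      using F[of t] that by (simp add: at_within_Icc_at)
    then show "\<exists>D. (F has_real_derivative D) (at t) \<and> 0 < D"
      using pos[of t] K t that by (intro exI[of _ "f t / K"]) auto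
  qed (use that in \<open>auto intro: continuous_on_subset[OF contF]\<close>)
  have inj: "inj_on F {0..1}"
    by (rule linorder_inj_onI') (use less in fastforce)
  have img: "F ` {0..1} = {0..1}"
  proof
    show "F ` {0..1} \<subseteq> {0..1}"
    proof (rule image_subsetI)
      fix x :: real assume "x \<in> {0..1}"
      then show "F x \<in> {0..1}"
        using less[of 0 x] less[of x 1] F01 by (cases "x = 0"; cases "x = 1") auto
    qed
    show "{0..1} \<subseteq> F ` {0..1}"
      using IVT'[of F 0 _ 1] contF F01 by fastforce
  qed
  define l where "l = the_inv_into {0..1} F"
  have l: "l s \<in> {0..1}" "F (l s) = s" if "s \<in> {0..1}" for s
    using that the_inv_into_into[OF inj, of s "{0..1}"] f_the_inv_into_f[OF inj, of s] img by (auto simp: l_def)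
  have "continuous_on {0..1} l"
    using continuous_on_inv[OF contF compact_Icc, of l] the_inv_into_f_f[OF inj] img by (simp add: l_def)
  then have "(l has_real_derivative inverse (f (l s) / K)) (at s within {0..1})" if s: "s \<in> {0..1}" for s
    using F[OF l(1)[OF s]] pos[OF l(1)[OF s]] K s l
    by (intro inverse_has_real_derivative_within[where T = "{0..1}" and f = F])
      (auto simp: continuous_on_eq_continuous_within)
  moreover have "l 0 = 0" "l 1 = 1"
    using the_inv_into_f_f[OF inj, of 0] the_inv_into_f_f[OF inj, of 1] F01 by (auto simp: l_def)
  ultimately show ?thesis using that l K by (simp add: K_def)
qed

section \<open>The orbit equation\<close>

text \<open>
  The nonlinearity \<open>3/2 u\<^sup>2\<close> of the orbit equation, made bounded and globally Lipschitz by freezing it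
  outside the physical range \<open>0 \<le> u \<le> 1\<close>.
\<close>

definition bend :: "real \<Rightarrow> real" where
  "bend x = 3 / 2 * (min 1 (max 0 x))\<^sup>2"

lemma bend_eq: "0 \<le> x \<Longrightarrow> x \<le> 1 \<Longrightarrow> bend x = 3 / 2 * x\<^sup>2"
  by (simp add: bend_def)

lemma bend_range: "0 \<le> bend x" "bend x \<le> 3 / 2"
  by (auto simp: bend_def power_le_one)

lemma bend_mono: "x \<le> y \<Longrightarrow> bend x \<le> bend y"
  by (auto simp: bend_def intro!: power_mono)

text \<open>The constant 3 is the slope of 3/2 x^2 at x = 1.\<close>

lemma bend_lipschitz_le: "x \<le> y \<Longrightarrow> bend y - bend x \<le> 3 * (y - x)"
proof -
  assume xy: "x \<le> y"
  define c d where "c = min 1 (max 0 x)" and "d = min 1 (max 0 y)"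
  have *: "0 \<le> c" "c \<le> d" "d \<le> 1" "d - c \<le> y - x" using xy by (auto simp: c_def d_def)
  have "d\<^sup>2 - c\<^sup>2 = (d + c) * (d - c)" by (simp add: power2_eq_square algebra_simps)
  also have "\<dots> \<le> 2 * (y - x)" using * by (intro mult_mono) auto
  finally show ?thesis by (simp add: bend_def c_def d_def)
qed

lemma bend_lipschitz: "\<bar>bend x - bend y\<bar> \<le> 3 * \<bar>x - y\<bar>"
  using bend_lipschitz_le[of x y] bend_lipschitz_le[of y x] bend_mono[of x y] bend_mono[of y x]
  by (cases "x \<le> y") auto

lemma continuous_on_bend [continuous_intros]:
  "continuous_on S f \<Longrightarrow> continuous_on S (\<lambda>x. bend (f x))"
  unfolding bend_def by (intro continuous_intros)

text \<open>\<open>a\<close> and \<open>b\<close> are the values of R/r at the two end points and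
  \<open>w\<close> is the angle between their position vectors. Keeping \<open>w\<close> as a
  coefficient over the fixed interval [0,1], instead of using the angle as parameter, treats the
  radial case \<open>w = 0\<close> together with the others.\<close>

locale orbit_equation =
  fixes w a b :: real
  assumes w: "0 \<le> w" "w \<le> pi" and a: "0 < a" "a < 1" and b: "0 < b" "b < 1"
begin

text \<open>
  The solutions of \<open>y'' + w\<^sup>2 y = 0\<close>, \<open>y(0) = 0\<close>, \<open>y'(0) = 1\<close> and of \<open>y'' + w\<^sup>2 y = 1\<close>, \<open>y(0) = y'(0) = 0\<close>.
\<close>

definition sn :: "real \<Rightarrow> real" where
  "sn x = (if w = 0 then x else sin (w * x) / w)"

definition vs :: "real \<Rightarrow> real" where
  "vs x = (if w = 0 then x\<^sup>2 / 2 else (1 - cos (w * x)) / w\<^sup>2)"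

lemma sn_0 [simp]: "sn 0 = 0" and vs_0 [simp]: "vs 0 = 0"
  by (auto simp: sn_def vs_def)

lemma sn_deriv [derivative_intros]:
  "(f has_field_derivative f') (at x within S) \<Longrightarrow>
   ((\<lambda>x. sn (f x)) has_real_derivative cos (w * f x) * f') (at x within S)"
  unfolding sn_def by (cases "w = 0") (auto intro!: derivative_eq_intros)

lemma cos_deriv: 
  "((\<lambda>x. cos (w * x)) has_real_derivative - w\<^sup>2 * sn x) (at x within S)"
  unfolding sn_def by (auto intro!: derivative_eq_intros simp: power2_eq_square)

lemma vs_deriv [derivative_intros]:
  "(f has_field_derivative f') (at x within S) \<Longrightarrow>
   ((\<lambda>x. vs (f x)) has_real_derivative sn (f x) * f') (at x within S)"
  unfolding sn_def vs_def by (cases "w = 0") (auto intro!: derivative_eq_intros simp: power2_eq_square)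

lemma cos_vs: "cos (w * x) = 1 - w\<^sup>2 * vs x"
  by (auto simp: vs_def)

lemma sn_diff: "sn (x - y) = sn x * cos (w * y) - cos (w * x) * sn y"
  by (auto simp: sn_def algebra_simps sin_diff diff_divide_distrib)

lemma cos_sn: "(cos (w * x))\<^sup>2 + w\<^sup>2 * (sn x)\<^sup>2 = 1"
  by (auto simp: sn_def power_divide)

lemma continuous_on_sn [continuous_intros]:
  "continuous_on S f \<Longrightarrow> continuous_on S (\<lambda>x. sn (f x))"
  by (rule continuous_on_compose2[of UNIV sn, OF continuous_at_imp_continuous_on])
    (auto intro!: DERIV_isCont derivative_eq_intros)

lemma continuous_on_vs [continuous_intros]:
  "continuous_on S f \<Longrightarrow> continuous_on S (\<lambda>x. vs (f x))"
  by (rule continuous_on_compose2[of UNIV vs, OF continuous_at_imp_continuous_on])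
    (auto intro!: DERIV_isCont derivative_eq_intros)

lemma sn_nonneg: "x \<in> {0..1} \<Longrightarrow> 0 \<le> sn x"
  using w mult_mono[of w pi x 1] by (auto simp: sn_def intro!: divide_nonneg_nonneg sin_ge_zero)

lemma sn_le: "0 \<le> x \<Longrightarrow> sn x \<le> x"
  using w sin_x_le_x[of "w * x"] by (auto simp: sn_def field_simps)

lemma sn_bounds: "x \<in> {0..1} \<Longrightarrow> 0 \<le> sn x \<and> sn x \<le> 1"
  using sn_nonneg sn_le[of x] by force

lemma vs_nonneg: "0 \<le> vs x"
  by (auto simp: vs_def)

lemma vs_le: "x \<in> {0..1} \<Longrightarrow> vs x \<le> 1"
proof -
  assume x: "x \<in> {0..1}"
  have "vs x - x \<le> vs 0 - 0"
    by (rule within_deriv_nonpos_imp_le[where f = "\<lambda>x. vs x - x" and f' = "\<lambda>x. sn x - 1"])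
       (use x sn_bounds in \<open>auto intro!: derivative_eq_intros\<close>)
  then show ?thesis using x by simp
qed

lemma vs_1_pos: "0 < vs 1"
proof (cases "w = 0")
  case False
  then have "cos w < cos 0" using w by (intro cos_monotone_0_pi) auto
  then show ?thesis using False by (simp add: vs_def)
next
  case True
  then show ?thesis unfolding vs_def by simp
qed

text \<open>
  \<open>forcing p A\<close> solves the linear equation \<open>y'' + w\<^sup>2 y = A\<close> with \<open>y(0) = a\<close>, \<open>y'(0) = p\<close>; \<open>response u\<close>
  below is the Duhamel term for the source \<open>w\<^sup>2 bend u\<close>.
\<close>

definition forcing :: "real \<Rightarrow> real \<Rightarrow> real \<Rightarrow> real" where
  "forcing p A x = a * cos (w * x) + p * sn x + A * vs x"

lemma continuous_on_forcing [continuous_intros]: "continuous_on S (forcing p A)"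
  unfolding forcing_def[abs_def] by (intro continuous_intros)

text \<open>The kernel sn (x - s) is expanded by the addition theorem, so that \<open>x\<close>
  occurs only outside the integrals and as upper limit and the term can be differentiated directly.
  \<open>response_eq\<close> restores the kernel form, which serves for estimates.\<close>

definition response :: "(real \<Rightarrow> real) \<Rightarrow> real \<Rightarrow> real" where
  "response u x = w\<^sup>2 * (sn x * integral {0..x} (\<lambda>s. cos (w * s) * bend (u s))
      - cos (w * x) * integral {0..x} (\<lambda>s. sn s * bend (u s)))"

lemma response_eq:
  assumes u: "continuous_on {0..1} u" and x: "x \<in> {0..1}"
  shows "response u x = w\<^sup>2 * integral {0..x} (\<lambda>s. sn (x - s) * bend (u s))"
proof -
  have c: "continuous_on {0..x} u" by (rule continuous_on_subset[OF u]) (use x in auto)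
  have i: "(\<lambda>s. cos (w * s) * bend (u s)) integrable_on {0..x}"
    "(\<lambda>s. sn s * bend (u s)) integrable_on {0..x}"
    by (intro integrable_continuous_real continuous_intros c)+
  have "integral {0..x} (\<lambda>s. sn (x - s) * bend (u s))
    = integral {0..x} (\<lambda>s. sn x * (cos (w * s) * bend (u s)) - cos (w * x) * (sn s * bend (u s)))"
    by (simp add: sn_diff algebra_simps)
  also have "\<dots> = sn x * integral {0..x} (\<lambda>s. cos (w * s) * bend (u s))
      - cos (w * x) * integral {0..x} (\<lambda>s. sn s * bend (u s))"
    using integrable_on_cmult_left[OF i(1), of "sn x"] integrable_on_cmult_left[OF i(2), of "cos (w * x)"]
    by (subst integral_diff) auto
  finally show ?thesis by (simp add: response_def)
qed

definition response_deriv :: "(real \<Rightarrow> real) \<Rightarrow> real \<Rightarrow> real" where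
  "response_deriv u x = w\<^sup>2 * (cos (w * x) * integral {0..x} (\<lambda>s. cos (w * s) * bend (u s))
      + w\<^sup>2 * sn x * integral {0..x} (\<lambda>s. sn s * bend (u s)))"

lemma response_has_deriv:
  assumes u: "continuous_on {0..1} u" and x: "x \<in> {0..1}"
  shows "(response u has_real_derivative response_deriv u x) (at x within {0..1})"
    and "(response_deriv u has_real_derivative w\<^sup>2 * (bend (u x) - response u x)) (at x within {0..1})"
proof -
  have c: "((\<lambda>x. integral {0..x} (\<lambda>s. cos (w * s) * bend (u s))) has_real_derivative
      cos (w * x) * bend (u x)) (at x within {0..1})"
    and s: "((\<lambda>x. integral {0..x} (\<lambda>s. sn s * bend (u s))) has_real_derivative
      sn x * bend (u x)) (at x within {0..1})"
    by (intro integral_has_real_derivative continuous_intros u x)+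
  show "(response u has_real_derivative response_deriv u x) (at x within {0..1})"
    unfolding response_def[abs_def] response_deriv_def
    by (rule derivative_eq_intros cos_deriv c s refl)+ (simp add: algebra_simps)
  \<comment> \<open>Differentiating the upper limits of \<open>response_deriv\<close> produces
    \<open>bend (u x)\<close> with exactly this factor.\<close>
  have *: "bend (u x) = ((cos (w * x))\<^sup>2 + w\<^sup>2 * (sn x)\<^sup>2) * bend (u x)" by (simp only: cos_sn)
  show "(response_deriv u has_real_derivative w\<^sup>2 * (bend (u x) - response u x)) (at x within {0..1})"
    unfolding response_def response_deriv_def[abs_def]
    by (subst *, (rule derivative_eq_intros cos_deriv c s refl)+) (simp add: algebra_simps power2_eq_square)
qed

text \<open>Kernel and source are nonnegative and bounded by 1 and 3/2. The bounds do not depend on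
  \<open>u\<close>, hence neither on the slope nor on A.\<close>

lemma response_bounds:
  assumes u: "continuous_on {0..1} u" and x: "x \<in> {0..1}"
  shows "0 \<le> response u x" "response u x \<le> 3 / 2 * w\<^sup>2"
proof -
  have c: "continuous_on {0..x} u" by (rule continuous_on_subset[OF u]) (use x in auto)
  have i: "(\<lambda>s. sn (x - s) * bend (u s)) integrable_on {0..x}"
    by (intro integrable_continuous_real continuous_intros c)
  have r: "0 \<le> sn (x - s) * bend (u s)" "sn (x - s) * bend (u s) \<le> 3 / 2" if "s \<in> {0..x}" for s
    using sn_bounds[of "x - s"] bend_range[of "u s"] that x mult_mono[of "sn (x - s)" 1 "bend (u s)" "3/2"]
    by auto
  have "0 \<le> integral {0..x} (\<lambda>s. sn (x - s) * bend (u s))"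
    by (rule integral_nonneg[OF i]) (use r in auto)
  moreover have "integral {0..x} (\<lambda>s. sn (x - s) * bend (u s)) \<le> integral {0..x} (\<lambda>s. 3 / 2)"
    by (rule integral_le[OF i]) (use r in auto)
  then have "integral {0..x} (\<lambda>s. sn (x - s) * bend (u s)) \<le> 3 / 2" using x by simp
  ultimately show "0 \<le> response u x" "response u x \<le> 3 / 2 * w\<^sup>2"
    using mult_left_mono[of "integral {0..x} (\<lambda>s. sn (x - s) * bend (u s))" "3/2" "w\<^sup>2"]
    by (auto simp: response_eq[OF u x] mult.commute)
qed

text \<open>One-sided on purpose: since the kernel lies between 0 and 1, an upper bound for the
  difference of sources is enough. This carries both the Lipschitz estimates and the monotonicity in
  A.\<close>

lemma response_diff_le:
  assumes u: "continuous_on {0..1} u" and v: "continuous_on {0..1} v" and x: "x \<in> {0..1}"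
    and M: "continuous_on {0..1} M" "\<And>s. s \<in> {0..1} \<Longrightarrow> bend (u s) - bend (v s) \<le> M s"
      "\<And>s. s \<in> {0..1} \<Longrightarrow> 0 \<le> M s"
  shows "response u x - response v x \<le> w\<^sup>2 * integral {0..x} M"
proof -
  have sub: "{0..x} \<subseteq> {0..1}" using x by auto
  note c = continuous_on_subset[OF u sub] continuous_on_subset[OF v sub] continuous_on_subset[OF M(1) sub]
  have i: "(\<lambda>s. sn (x - s) * bend (u s)) integrable_on {0..x}"
    "(\<lambda>s. sn (x - s) * bend (v s)) integrable_on {0..x}" "M integrable_on {0..x}"
    by (intro integrable_continuous_real continuous_intros c)+
  have "integral {0..x} (\<lambda>s. sn (x - s) * bend (u s)) - integral {0..x} (\<lambda>s. sn (x - s) * bend (v s))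
     = integral {0..x} (\<lambda>s. sn (x - s) * (bend (u s) - bend (v s)))"
    using integral_diff[OF i(1,2)] by (simp add: right_diff_distrib)
  also have "\<dots> \<le> integral {0..x} M"
  proof (rule integral_le)
    show "(\<lambda>s. sn (x - s) * (bend (u s) - bend (v s))) integrable_on {0..x}"
      by (intro integrable_continuous_real continuous_intros c)
    fix s assume s: "s \<in> {0..x}"
    then have "x - s \<in> {0..1}" "s \<in> {0..1}" using x by auto
    then have "sn (x - s) * (bend (u s) - bend (v s)) \<le> sn (x - s) * M s" "sn (x - s) * M s \<le> 1 * M s"
      using sn_bounds[of "x - s"] M(2,3)[of s] mult_right_mono[of "sn (x - s)" 1 "M s"]
      by (auto intro!: mult_left_mono)
    then show "sn (x - s) * (bend (u s) - bend (v s)) \<le> M s" by simp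
  qed (rule i)
  finally show ?thesis
    using mult_left_mono[of _ _ "w\<^sup>2"] 
    by (simp add: response_eq[OF u x] response_eq[OF v x] flip: right_diff_distrib)
qed

subsection \<open>Existence and dependence on parameters\<close>

text \<open>Picard iteration, contracting after weighting the supremum norm by \<open>exp (- c x)\<close>.\<close>

lemma ex_solution:
  assumes g: "continuous_on {0..1} g"
  shows "\<exists>u. continuous_on {0..1} u \<and> (\<forall>x\<in>{0..1}. u x = g x + response u x)"
proof -
  \<comment> \<open>Integrating 3 exp (c s) costs a factor 3/c, so the contraction constant is 3 w^2
    / c <= 1/2. The summand 1 keeps \<open>c\<close> positive when \<open>w = 0\<close>.\<close>
  define c where "c = 6 * w\<^sup>2 + 1"
  have c: "c > 0" by (simp add: c_def add_nonneg_pos)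
  \<comment> \<open>Composition with \<open>cut\<close> extends functions on [0,1] to bounded
    continuous functions on the line, a complete space.\<close>
  define cut :: "real \<Rightarrow> real" where "cut x = min 1 (max 0 x)" for x
  have cut: "cut x \<in> {0..1}" for x by (auto simp: cut_def)
  have cont_cut: "continuous_on UNIV cut" unfolding cut_def[abs_def] by (intro continuous_intros)
  \<comment> \<open>The iteration runs on \<open>v\<close>, the candidate divided by exp (c s), so
    that the plain supremum distance of the \<open>v\<close> is the weighted one of the
    candidates.\<close>
  define u where "u v s = exp (c * s) * apply_bcontfun v s" for v :: "real \<Rightarrow>\<^sub>C real" and s
  have u: "continuous_on {0..1} (u v)" for v
    unfolding u_def by (intro continuous_intros continuous_on_apply_bcontfun)
  define T0 where "T0 v y = exp (- c * y) * (g y + response (u v) y)" for v y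
  have T0: "continuous_on {0..1} (T0 v)" for v
    unfolding T0_def using response_has_deriv(1)[OF u, THEN DERIV_continuous]
    by (intro continuous_intros g) (auto simp: continuous_on_eq_continuous_within)
  have "(\<lambda>x. T0 v (cut x)) \<in> bcontfun" for v
  proof -
    have "continuous_on UNIV (\<lambda>x. T0 v (cut x))"
      by (rule continuous_on_compose2[OF T0 cont_cut]) (rule image_subsetI, rule cut)
    moreover have "bounded (range (\<lambda>x. T0 v (cut x)))"
      by (rule bounded_subset[OF compact_imp_bounded[OF compact_continuous_image[OF T0 compact_Icc]]])
        (rule image_subsetI, rule imageI, rule cut)
    ultimately show ?thesis by (simp add: bcontfun_def)
  qed
  then have T: "apply_bcontfun (Bcontfun (\<lambda>x. T0 v (cut x))) = (\<lambda>x. T0 v (cut x))" for v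
    by (rule Bcontfun_inverse)
  have "dist (Bcontfun (\<lambda>x. T0 v (cut x))) (Bcontfun (\<lambda>x. T0 v' (cut x))) \<le> 1 / 2 * dist v v'" for v v'
  proof (rule dist_bound)
    fix x
    define y where "y = cut x"
    have y: "y \<in> {0..1}" unfolding y_def by (rule cut)
    have *: "response (u v1) y - response (u v2) y \<le> exp (c * y) * (1 / 2 * dist v1 v2)" for v1 v2
    proof -
      let ?M = "\<lambda>s. 3 * dist v1 v2 * exp (c * s)"
      have "((\<lambda>s. 3 * dist v1 v2 * exp (c * s)) has_integral
        (3 * dist v1 v2 * exp (c * y) / c - 3 * dist v1 v2 * exp (c * 0) / c)) {0..y}"
      proof (rule fundamental_theorem_of_calculus)
        fix s
        show "((\<lambda>s. 3 * dist v1 v2 * exp (c * s) / c) has_vector_derivative 3 * dist v1 v2 * exp (c * s))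
            (at s within {0..y})"
          unfolding has_real_derivative_iff_has_vector_derivative[symmetric]
          using c by (auto intro!: derivative_eq_intros)
      qed (use y in auto)
      then have "integral {0..y} ?M = 3 * dist v1 v2 * exp (c * y) / c - 3 * dist v1 v2 / c"
        by (simp only: integral_unique mult_zero_right exp_zero mult_1_right)
      then have I: "integral {0..y} ?M \<le> 3 * dist v1 v2 * exp (c * y) / c"
        using c by auto
      have "response (u v1) y - response (u v2) y \<le> w\<^sup>2 * integral {0..y} ?M"
      proof (rule response_diff_le[OF u u y])
        fix s :: real
        have "bend (u v1 s) - bend (u v2 s) \<le> 3 * \<bar>u v1 s - u v2 s\<bar>"
          using bend_lipschitz[of "u v1 s" "u v2 s"] by linarith
        also have "u v1 s - u v2 s = exp (c * s) * (apply_bcontfun v1 s - apply_bcontfun v2 s)"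
          by (simp add: u_def right_diff_distrib)
        also have "\<bar>\<dots>\<bar> = exp (c * s) * dist (apply_bcontfun v1 s) (apply_bcontfun v2 s)"
          by (simp add: dist_real_def abs_mult)
        also have "\<dots> \<le> exp (c * s) * dist v1 v2"
          by (intro mult_left_mono dist_bounded) auto
        finally show "bend (u v1 s) - bend (u v2 s) \<le> ?M s" by (simp add: mult_ac)
      qed (auto intro!: continuous_intros)
      also have "\<dots> \<le> w\<^sup>2 * (3 * dist v1 v2 * exp (c * y) / c)"
        by (intro mult_left_mono I) auto
      also have "\<dots> = (3 * w\<^sup>2 / c) * (dist v1 v2 * exp (c * y))" by simp
      also have "\<dots> \<le> (1 / 2) * (dist v1 v2 * exp (c * y))"
        using c by (intro mult_right_mono) (auto simp: c_def field_simps)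
      finally show ?thesis by (simp add: mult_ac)
    qed
    have "\<bar>response (u v) y - response (u v') y\<bar> \<le> exp (c * y) * (1 / 2 * dist v v')"
      using *[of v v'] *[of v' v] unfolding dist_commute[of v' v] by linarith
    then have "exp (- c * y) * \<bar>response (u v) y - response (u v') y\<bar>
        \<le> exp (- c * y) * (exp (c * y) * (1 / 2 * dist v v'))"
      by (intro mult_left_mono) auto
    also have "\<dots> = 1 / 2 * dist v v'"
      by (simp add: mult.assoc[symmetric] flip: exp_add)
    also have "exp (- c * y) * \<bar>response (u v) y - response (u v') y\<bar> = \<bar>T0 v y - T0 v' y\<bar>"
    proof -
      have "T0 v y - T0 v' y = exp (- c * y) * (response (u v) y - response (u v') y)"
        by (simp add: T0_def algebra_simps)
      then show ?thesis by (simp add: abs_mult)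
    qed
    finally show "dist (apply_bcontfun (Bcontfun (\<lambda>x. T0 v (cut x))) x)
       (apply_bcontfun (Bcontfun (\<lambda>x. T0 v' (cut x))) x) \<le> 1 / 2 * dist v v'"
      unfolding T y_def[symmetric] by (simp add: dist_real_def)
  qed
  then obtain v where v: "Bcontfun (\<lambda>x. T0 v (cut x)) = v"
    using banach_fix_type[of "1/2" "\<lambda>v. Bcontfun (\<lambda>x. T0 v (cut x))"] by auto
  have "u v x = g x + response (u v) x" if x: "x \<in> {0..1}" for x
  proof -
    have "apply_bcontfun v = (\<lambda>x. T0 v (cut x))" using T[of v] unfolding v .
    moreover have "cut x = x" using x by (simp add: cut_def)
    ultimately have "apply_bcontfun v x = T0 v x" by simp
    then have "u v x = exp (c * x) * exp (- c * x) * (g x + response (u v) x)"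
      by (simp add: u_def T0_def)
    then show ?thesis by (simp flip: exp_add)
  qed
  with u show ?thesis by blast
qed

text \<open>Gronwall's inequality with the Lipschitz constant 3 of \<open>bend\<close> and the
  kernel bound 1. The case \<open>g = h\<close> gives uniqueness on [0,1], so the choice made in
  \<open>sol\<close> is immaterial there.\<close>

lemma solution_lipschitz:
  assumes u: "continuous_on {0..1} u" "\<And>x. x \<in> {0..1} \<Longrightarrow> u x = g x + response u x"
    and v: "continuous_on {0..1} v" "\<And>x. x \<in> {0..1} \<Longrightarrow> v x = h x + response v x"
    and gh: "\<And>x. x \<in> {0..1} \<Longrightarrow> \<bar>g x - h x\<bar> \<le> e" and x: "x \<in> {0..1}"
  shows "\<bar>u x - v x\<bar> \<le> exp (3 * w\<^sup>2) * e"
proof -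
  have *: "\<bar>u y - v y\<bar> \<le> e + 3 * w\<^sup>2 * integral {0..y} (\<lambda>s. \<bar>u s - v s\<bar>)" if y: "y \<in> {0..1}" for y
  proof -
    let ?M = "\<lambda>s. 3 * \<bar>u s - v s\<bar>"
    have M: "continuous_on {0..1} ?M" by (intro continuous_intros u v)
    have "response u y - response v y \<le> w\<^sup>2 * integral {0..y} ?M"
      by (rule response_diff_le[OF u(1) v(1) y M abs_le_D1[OF bend_lipschitz]]) auto
    moreover have "response v y - response u y \<le> w\<^sup>2 * integral {0..y} ?M"
      by (rule response_diff_le[OF v(1) u(1) y M])
        (use bend_lipschitz in \<open>auto simp: abs_le_iff algebra_simps\<close>)
    ultimately have "\<bar>response u y - response v y\<bar> \<le> 3 * w\<^sup>2 * integral {0..y} (\<lambda>s. \<bar>u s - v s\<bar>)"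
      by simp
    then show ?thesis using gh[OF y] u(2)[OF y] v(2)[OF y] by linarith
  qed
  have "\<bar>u x - v x\<bar> \<le> e * exp (3 * w\<^sup>2 * x)"
    using * by (intro gronwall[OF _ _ _ x] continuous_intros u v) auto
  also have "\<dots> \<le> e * exp (3 * w\<^sup>2)"
    using x gh[OF x] mult_left_le[of x "w\<^sup>2"] by (intro mult_left_mono) auto
  finally show ?thesis by (simp add: mult.commute)
qed

definition sol :: "real \<Rightarrow> real \<Rightarrow> real \<Rightarrow> real" where
  "sol p A = (SOME u. continuous_on {0..1} u \<and> (\<forall>x\<in>{0..1}. u x = forcing p A x + response u x))"

lemma continuous_on_sol: "continuous_on {0..1} (sol p A)"
  and sol_eq: "x \<in> {0..1} \<Longrightarrow> sol p A x = forcing p A x + response (sol p A) x"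
  using someI_ex[OF ex_solution[OF continuous_on_forcing[of _ p A]]] by (auto simp: sol_def)

lemma sol_lipschitz:
  assumes x: "x \<in> {0..1}"
  shows "\<bar>sol p A x - sol q B x\<bar> \<le> exp (3 * w\<^sup>2) * (\<bar>p - q\<bar> + \<bar>A - B\<bar>)"
proof (rule solution_lipschitz[OF continuous_on_sol sol_eq continuous_on_sol sol_eq _ x])
  fix y :: real assume y: "y \<in> {0..1}"
  have "forcing p A y - forcing q B y = (p - q) * sn y + (A - B) * vs y"
    by (simp add: forcing_def algebra_simps)
  also have "\<bar>\<dots>\<bar> \<le> \<bar>p - q\<bar> * sn y + \<bar>A - B\<bar> * vs y"
    using sn_nonneg[OF y] vs_nonneg[of y]
      abs_triangle_ineq[of "(p - q) * sn y" "(A - B) * vs y"] by (simp add: abs_mult)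
  also have "\<dots> \<le> \<bar>p - q\<bar> * 1 + \<bar>A - B\<bar> * 1"
    using sn_bounds[OF y] vs_le[OF y] by (intro add_mono mult_left_mono) auto
  finally show "\<bar>forcing p A y - forcing q B y\<bar> \<le> \<bar>p - q\<bar> + \<bar>A - B\<bar>" by simp
qed

text \<open>The positive part \<open>d\<close> of the difference satisfies a homogeneous Gronwall
  inequality, so it vanishes and solutions are ordered like A. The forcing term alone then gives the
  rate \<open>vs 1\<close>, which makes shooting quantitative.\<close>

lemma sol_end_mono:
  assumes "A \<le> B"
  shows "(B - A) * vs 1 \<le> sol p B 1 - sol p A 1"
proof -
  define d where "d x = max 0 (sol p A x - sol p B x)" for x
  have d: "continuous_on {0..1} d"
    unfolding d_def by (intro continuous_intros continuous_on_sol)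
  have step: "sol p A y - sol p B y \<le> (A - B) * vs y + w\<^sup>2 * integral {0..y} M"
    if y: "y \<in> {0..1}" and M: "continuous_on {0..1} M"
      "\<And>s. s \<in> {0..1} \<Longrightarrow> bend (sol p A s) - bend (sol p B s) \<le> M s"
      "\<And>s. s \<in> {0..1} \<Longrightarrow> 0 \<le> M s" for y M
    using response_diff_le[OF continuous_on_sol continuous_on_sol y M(1), of p A p B] M(2,3)
      sol_eq[OF y, of p A] sol_eq[OF y, of p B]
    by (simp add: forcing_def algebra_simps)
  have "d y \<le> 0 + 3 * w\<^sup>2 * integral {0..y} d" if y: "y \<in> {0..1}" for y
  proof -
    have "bend (sol p A s) - bend (sol p B s) \<le> 3 * d s" for s
      using bend_mono[of "sol p A s" "sol p B s"] bend_lipschitz_le[of "sol p B s" "sol p A s"]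
      by (cases "sol p A s \<le> sol p B s") (auto simp: d_def max_def)
    then have "sol p A y - sol p B y \<le> (A - B) * vs y + w\<^sup>2 * integral {0..y} (\<lambda>s. 3 * d s)"
      by (intro step[OF y] continuous_intros d) (auto simp: d_def)
    moreover have "(A - B) * vs y \<le> 0"
      using assms vs_nonneg by (simp add: mult_nonpos_nonneg)
    moreover have "0 \<le> integral {0..y} d"
      using y by (intro integral_nonneg integrable_continuous_real continuous_on_subset[OF d]) (auto simp: d_def)
    ultimately show ?thesis by (simp add: d_def[of y])
  qed
  then have "d x \<le> 0 * exp (3 * w\<^sup>2 * x)" if "x \<in> {0..1}" for x
    using that by (intro gronwall d) auto
  then have "sol p A x \<le> sol p B x" if "x \<in> {0..1}" for x
    using that by (force simp: d_def)
  \<comment> \<open>By the order just found the difference of sources is nonpositive, so the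
    estimate applies with majorant 0.\<close>
  then have "sol p A 1 - sol p B 1 \<le> (A - B) * vs 1 + w\<^sup>2 * integral {0..1} (\<lambda>s. 0)"
    using step[of 1 "\<lambda>s. 0"] by (auto intro: bend_mono)
  then show ?thesis by (simp add: algebra_simps)
qed

section \<open>Shooting for the end value \<open>b\<close>\<close>

lemma ex_shoot: "\<exists>A. sol p A 1 = b"
proof -
  \<comment> \<open>These solve the equation at x = 1 for A with the response replaced by its
    largest value 3/2 w^2 and its smallest value 0.\<close>
  define lo hi where "lo = (b - 3 / 2 * w\<^sup>2 - a * cos w - p * sn 1) / vs 1"
    and "hi = (b - a * cos w - p * sn 1) / vs 1"
  have eq: "sol p A 1 = a * cos w + p * sn 1 + A * vs 1 + response (sol p A) 1" for A
    using sol_eq[of 1 p A] by (simp add: forcing_def)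
  have "\<exists>A. lo \<le> A \<and> A \<le> hi \<and> sol p A 1 = b"
  proof (rule IVT')
    show "sol p lo 1 \<le> b" "b \<le> sol p hi 1"
      using eq[of lo] eq[of hi] vs_1_pos response_bounds[OF continuous_on_sol, of 1 p lo]
        response_bounds[OF continuous_on_sol, of 1 p hi]
      by (auto simp: lo_def hi_def)
    show "lo \<le> hi" using vs_1_pos by (auto simp: lo_def hi_def intro!: divide_right_mono)
    have "(exp (3 * w\<^sup>2))-lipschitz_on {lo..hi} (\<lambda>A. sol p A 1)"
      using sol_lipschitz[of 1 p _ p] by (intro lipschitz_onI) (auto simp: dist_real_def)
    then show "continuous_on {lo..hi} (\<lambda>A. sol p A 1)" by (rule lipschitz_on_continuous_on)
  qed
  then show ?thesis by blast
qed

definition shoot :: "real \<Rightarrow> real" where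
  "shoot p = (SOME A. sol p A 1 = b)"

lemma sol_shoot: "sol p (shoot p) 1 = b"
  using someI_ex[OF ex_shoot] by (simp add: shoot_def)

text \<open>A change of slope moves the end value by at most exp (3 w^2) times its size, a change of
  A moves it by at least \<open>vs 1\<close> times its size, and the two must cancel.\<close>

lemma shoot_lipschitz: "\<bar>shoot p - shoot q\<bar> \<le> exp (3 * w\<^sup>2) / vs 1 * \<bar>p - q\<bar>"
proof -
  have "\<bar>shoot p - shoot q\<bar> * vs 1 \<le> \<bar>sol p (shoot p) 1 - sol p (shoot q) 1\<bar>"
    using sol_end_mono[of "shoot p" "shoot q" p] sol_end_mono[of "shoot q" "shoot p" p]
    by (cases "shoot p \<le> shoot q") auto
  also have "\<dots> = \<bar>sol q (shoot q) 1 - sol p (shoot q) 1\<bar>" by (simp add: sol_shoot)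
  also have "\<dots> \<le> exp (3 * w\<^sup>2) * \<bar>p - q\<bar>" using sol_lipschitz[of 1 q "shoot q" p "shoot q"]
    by (simp add: abs_minus_commute)
  finally show ?thesis using vs_1_pos by (simp add: field_simps)
qed

definition U :: "real \<Rightarrow> real \<Rightarrow> real" where
  "U p = sol p (shoot p)"

definition V :: "real \<Rightarrow> real \<Rightarrow> real" where
  "V p x = - a * w\<^sup>2 * sn x + p * cos (w * x) + shoot p * sn x + response_deriv (U p) x"

lemma U_eq: "x \<in> {0..1} \<Longrightarrow> U p x = forcing p (shoot p) x + response (U p) x"
  unfolding U_def by (rule sol_eq)

lemma continuous_on_U: "continuous_on {0..1} (U p)"
  unfolding U_def by (rule continuous_on_sol)

lemma U_0 [simp]: "U p 0 = a" and U_1 [simp]: "U p 1 = b" and V_0 [simp]: "V p 0 = p"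
  using U_eq[of 0 p] by (auto simp: forcing_def response_def response_deriv_def V_def U_def sol_shoot)

lemma U_deriv:
  assumes x: "x \<in> {0..1}"
  shows "(U p has_real_derivative V p x) (at x within {0..1})"
proof (rule has_field_derivative_transform_within[OF _ zero_less_one x])
  show "((\<lambda>x. forcing p (shoot p) x + response (U p) x) has_real_derivative V p x) (at x within {0..1})"
    unfolding forcing_def V_def
    by (rule derivative_eq_intros cos_deriv response_has_deriv[OF continuous_on_U x] refl)+ simp
qed (simp add: U_eq)

lemma V_deriv:
  assumes x: "x \<in> {0..1}"
  shows "(V p has_real_derivative shoot p - w\<^sup>2 * U p x + w\<^sup>2 * bend (U p x)) (at x within {0..1})"
  unfolding V_def[abs_def] U_eq[OF x, of p]
  by (rule derivative_eq_intros cos_deriv response_has_deriv[OF continuous_on_U x] refl)+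
    (simp add: U_eq[OF x, of p] forcing_def cos_vs algebra_simps)

lemma U_lipschitz: "\<exists>M>0. \<forall>p q. \<forall>x\<in>{0..1}. \<bar>U p x - U q x\<bar> \<le> M * \<bar>p - q\<bar>"
proof (intro exI conjI allI ballI)
  let ?M = "exp (3 * w\<^sup>2) * (1 + exp (3 * w\<^sup>2) / vs 1)"
  show "?M > 0" using vs_1_pos by (simp add: add_pos_pos)
  fix p q x :: real assume "x \<in> {0..1}"
  then have "\<bar>U p x - U q x\<bar> \<le> exp (3 * w\<^sup>2) * (\<bar>p - q\<bar> + \<bar>shoot p - shoot q\<bar>)"
    unfolding U_def by (rule sol_lipschitz)
  also have "\<dots> \<le> exp (3 * w\<^sup>2) * (\<bar>p - q\<bar> + exp (3 * w\<^sup>2) / vs 1 * \<bar>p - q\<bar>)"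
    by (intro mult_left_mono add_left_mono shoot_lipschitz) auto
  finally show "\<bar>U p x - U q x\<bar> \<le> ?M * \<bar>p - q\<bar>" by (simp add: algebra_simps)
qed

lemma continuous_on_shoot: "continuous_on S shoot"
proof -
  have "(exp (3 * w\<^sup>2) / vs 1)-lipschitz_on S shoot"
    using shoot_lipschitz vs_1_pos by (intro lipschitz_onI) (auto simp: dist_real_def)
  then show ?thesis by (rule lipschitz_on_continuous_on)
qed

text \<open>Continuity in \<open>x\<close> together with a Lipschitz constant in the slope that is
  uniform in \<open>x\<close>. It yields compact contact sets in \<open>ex_thresholds\<close> and
  continuity of \<open>lapse\<close>.\<close>

lemma continuous_on_U_joint: "continuous_on (S \<times> {0..1}) (\<lambda>(p, x). U p x)"
proof -
  obtain M where M: "M > 0" "\<And>p q x. x \<in> {0..1} \<Longrightarrow> \<bar>U p x - U q x\<bar> \<le> M * \<bar>p - q\<bar>"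
    using U_lipschitz by blast
  have M_lip: "M-lipschitz_on X (\<lambda>p. U p x)" if "x \<in> {0..1}" for x X
    using M that by (intro lipschitz_onI) (auto simp: dist_real_def)
  have "local_lipschitz {0..1} S (\<lambda>x p. U p x)"
  proof (rule local_lipschitzI)
    fix x p :: real
    have "\<forall>y\<in>cball x 1 \<inter> {0..1}. M-lipschitz_on (cball p 1 \<inter> S) (\<lambda>p. U p y)"
      by (intro ballI M_lip) simp
    then show "\<exists>u>0. \<exists>L. \<forall>y\<in>cball x u \<inter> {0..1}. L-lipschitz_on (cball p u \<inter> S) (\<lambda>p. U p y)"
      using zero_less_one by blast
  qed
  then have "continuous_on ({0..1} \<times> S) (\<lambda>(x, p). U p x)"
    by (rule continuous_on_TimesI) (rule continuous_on_U)
  then have "continuous_on (S \<times> {0..1}) (\<lambda>z. case prod.swap z of (x, p) \<Rightarrow> U p x)"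
    by (rule continuous_on_compose2) (auto simp: prod.swap_def intro!: continuous_intros)
  then show ?thesis by (simp add: prod.swap_def case_prod_beta)
qed

subsection \<open>Extreme initial slopes\<close>

text \<open>Up to the factor 1 / vs 1, the right-hand side is the coefficient of the slope in
  \<open>U\<close> once A is eliminated. For w > 0 it equals 4 sin (w/2) sin (w x/2) sin (w (1 -
  x)/2) / w^3, and both half angles containing \<open>x\<close> lie in [0, pi/2], where Jordan's
  inequality applies.\<close>

lemma bump_ge: "\<exists>k>0. \<forall>x\<in>{0..1}. k * (x * (1 - x)) \<le> sn x * vs 1 - sn 1 * vs x"
proof (cases "w = 0")
  case True
  have "1 / 2 * (x * (1 - x)) \<le> sn x * vs 1 - sn 1 * vs x" for x
    unfolding sn_def vs_def using True by (simp add: power2_eq_square field_simps)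
  then show ?thesis by (intro exI[of _ "1/2"]) auto
next
  case False
  then have w0: "w > 0" using w by simp
  have s: "sin (w / 2) > 0" using w0 w by (intro sin_gt_zero) auto
  \<comment> \<open>The two factors 2/pi * (w/2) are the Jordan bounds of the last two sines, with
    \<open>x\<close> and \<open>1 - x\<close> split off.\<close>
  define k where "k = 4 / w ^ 3 * sin (w / 2) * (2 / pi * (w / 2)) * (2 / pi * (w / 2))"
  have "k > 0" using w0 s by (simp add: k_def)
  moreover have "k * (x * (1 - x)) \<le> sn x * vs 1 - sn 1 * vs x" if x: "x \<in> {0..1}" for x
  proof -
    define y z where "y = w / 2 * x" and "z = w / 2 * (1 - x)"
    have yz: "0 \<le> y" "y \<le> pi / 2" "0 \<le> z" "z \<le> pi / 2"
      using w x mult_mono[of "w / 2" "pi / 2" x 1] mult_mono[of "w / 2" "pi / 2" "1 - x" 1]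
      by (auto simp: y_def z_def)
    have "k * (x * (1 - x)) = 4 / w ^ 3 * sin (w / 2) * ((2 / pi * y) * (2 / pi * z))"
      by (simp add: k_def y_def z_def mult_ac)
    also have "\<dots> \<le> 4 / w ^ 3 * sin (w / 2) * (sin y * sin z)"
      using w0 s yz by (intro mult_left_mono mult_mono sin_ge_two_over_pi sin_ge_zero) auto
    also have "\<dots> = sn x * vs 1 - sn 1 * vs x"
    proof -
      have e: "w * x = 2 * y" "w = 2 * (y + z)" by (simp_all add: y_def z_def field_simps)
      have h: "sin (2 * y) * (1 - cos (2 * (y + z))) - sin (2 * (y + z)) * (1 - cos (2 * y))
        = 4 * sin (y + z) * (sin y * sin z)"
      proof -
        have "sin z = sin ((y + z) - y)" by simp
        then have "sin z = sin (y + z) * cos y - cos (y + z) * sin y" by (simp only: sin_diff)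
        then show ?thesis
          unfolding sin_double cos_double_sin by algebra
      qed
      have "sn x * vs 1 - sn 1 * vs x
        = (sin (w * x) * (1 - cos w) - sin w * (1 - cos (w * x))) / w ^ 3"
        using False by (simp add: sn_def vs_def power2_eq_square power3_eq_cube right_diff_distrib diff_divide_distrib)
      also have "\<dots> = 4 * sin (y + z) * (sin y * sin z) / w ^ 3"
        using h unfolding e(1) e(2)[symmetric] by simp
      also have "y + z = w / 2" using e(2) by simp
      finally show ?thesis by simp
    qed
    finally show ?thesis .
  qed
  ultimately show ?thesis by blast
qed

text \<open>The slope enters linearly, up to a remainder with fixed end values and a second
  derivative bounded uniformly in the slope. Since the error vanishes like x (1 - x), as the linear
  term does, a large slope dominates it even near the end points.\<close>

lemma U_decomposition:
  "\<exists>B. \<forall>p. \<exists>R. (\<forall>x\<in>{0..1}. U p x = p * (sn x * vs 1 - sn 1 * vs x) / vs 1 + R x \<and>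
      \<bar>R x - ((1 - x) * a + x * b)\<bar> \<le> B * (x * (1 - x)))"
proof -
  \<comment> \<open>The boundary condition at 1 gives
    \<open>shoot p = c p - p * sn 1 / vs 1\<close>; \<open>c p\<close> is bounded uniformly in
    \<open>p\<close>.\<close>
  define c where "c p = (b - a * cos w - response (U p) 1) / vs 1" for p
  define R where "R p x = a * cos (w * x) + c p * vs x + response (U p) x" for p x
  define R' where "R' p x = - a * w\<^sup>2 * sn x + c p * sn x + response_deriv (U p) x" for p x
  define R'' where "R'' p x = - a * w\<^sup>2 * cos (w * x) + c p * cos (w * x) + w\<^sup>2 * (bend (U p x) - response (U p) x)" for p x
  \<comment> \<open>The three summands bound the three terms of \<open>R''\<close>; the middle one
    uses that \<open>b\<close>, \<open>a * cos w\<close> and the response are at most 1, 1 and 3/2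
    w^2 in absolute value.\<close>
  define B where "B = w\<^sup>2 + (2 + 3 / 2 * w\<^sup>2) / vs 1 + w\<^sup>2 * (3 / 2 + 3 / 2 * w\<^sup>2)"
  have r: "0 \<le> response (U p) x" "response (U p) x \<le> 3 / 2 * w\<^sup>2" if "x \<in> {0..1}" for p x
    using response_bounds[OF continuous_on_U that] by auto
  have U: "U p x = p * (sn x * vs 1 - sn 1 * vs x) / vs 1 + R p x" if x: "x \<in> {0..1}" for p x
  proof -
    have "b = a * cos w + p * sn 1 + shoot p * vs 1 + response (U p) 1"
      using U_eq[of 1 p] by (simp add: forcing_def)
    then have "shoot p = (b - a * cos w - response (U p) 1 - p * sn 1) / vs 1"
      using vs_1_pos by (simp add: eq_divide_eq)
    then have "shoot p = c p - p * sn 1 / vs 1"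
      by (simp add: c_def diff_divide_distrib)
    moreover have "p * (sn x * vs 1 - sn 1 * vs x) / vs 1 = p * sn x - p * sn 1 / vs 1 * vs x"
      using vs_1_pos by (simp add: field_simps)
    ultimately show ?thesis
      using U_eq[OF x, of p] by (simp add: forcing_def R_def left_diff_distrib)
  qed
  have R: "(R p has_real_derivative R' p x) (at x within {0..1})" if x: "x \<in> {0..1}" for p x
    unfolding R_def[abs_def] R'_def
    by (rule derivative_eq_intros cos_deriv response_has_deriv[OF continuous_on_U x] refl)+ simp
  have R': "(R' p has_real_derivative R'' p x) (at x within {0..1})" if x: "x \<in> {0..1}" for p x
    unfolding R'_def[abs_def] R''_def
    by (rule derivative_eq_intros cos_deriv response_has_deriv[OF continuous_on_U x] refl)+ simp
  have R'': "\<bar>R'' p x\<bar> \<le> B" if x: "x \<in> {0..1}" for p x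
  proof -
    have "\<bar>b - a * cos w - response (U p) 1\<bar> \<le> \<bar>b\<bar> + \<bar>a * cos w\<bar> + \<bar>response (U p) 1\<bar>" by linarith
    also have "\<bar>a * cos w\<bar> \<le> 1 * 1" unfolding abs_mult using a by (intro mult_mono) auto
    finally have "\<bar>c p\<bar> \<le> (2 + 3 / 2 * w\<^sup>2) / vs 1"
      using b r[of 1 p] vs_1_pos by (simp add: c_def divide_right_mono)
    moreover have "\<bar>c p * cos (w * x)\<bar> \<le> \<bar>c p\<bar> * 1" unfolding abs_mult by (intro mult_left_mono) auto
    moreover have "\<bar>- a * w\<^sup>2 * cos (w * x)\<bar> \<le> 1 * w\<^sup>2 * 1"
      unfolding abs_mult using a by (intro mult_mono) auto
    moreover have "\<bar>bend (U p x) - response (U p) x\<bar> \<le> 3 / 2 + 3 / 2 * w\<^sup>2"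
      using r[OF x, of p] bend_range[of "U p x"] zero_le_power2[of w] by linarith
    then have "\<bar>w\<^sup>2 * (bend (U p x) - response (U p) x)\<bar> \<le> w\<^sup>2 * (3 / 2 + 3 / 2 * w\<^sup>2)"
      unfolding abs_mult by (intro mult_mono) auto
    ultimately show ?thesis unfolding R''_def B_def by linarith
  qed
  have R0: "R p 0 = a" for p using U[of 0 p] by simp
  have R1: "R p 1 = b" for p using U[of 1 p] vs_1_pos by simp
  have "\<bar>R p x - ((1 - x) * a + x * b)\<bar> \<le> B / 2 * (x * (1 - x))" if x: "x \<in> {0..1}" for p x
  proof -
    have "R p x \<le> (1 - x) * R p 0 + x * R p 1 + B / 2 * (x * (1 - x))"
      using R'' by (intro le_chord_plus_parabola[OF R R' _ x]) (auto simp: abs_le_iff minus_le_iff)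
    moreover have "- R p x \<le> (1 - x) * (- R p 0) + x * (- R p 1) + B / 2 * (x * (1 - x))"
      using R'' by (intro le_chord_plus_parabola[OF DERIV_minus[OF R] DERIV_minus[OF R'] _ x])
        (auto simp: abs_le_iff minus_le_iff)
    ultimately show ?thesis unfolding R0 R1 by linarith
  qed
  with U show ?thesis by (intro exI[of _ "B / 2"]) blast
qed

lemma ex_extreme_slopes:
  "\<exists>p q. p < q \<and> (\<forall>x\<in>{0..1}. U p x < 1) \<and> U p (1 / 2) \<le> 0 \<and> 1 \<le> U q (1 / 2)"
proof -
  obtain B where B: "\<And>p. \<exists>R. (\<forall>x\<in>{0..1}. U p x = p * (sn x * vs 1 - sn 1 * vs x) / vs 1 + R x \<and>
      \<bar>R x - ((1 - x) * a + x * b)\<bar> \<le> B * (x * (1 - x)))" using U_decomposition by blast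
  obtain k where k: "k > 0" "\<And>x. x \<in> {0..1} \<Longrightarrow> k * (x * (1 - x)) \<le> sn x * vs 1 - sn 1 * vs x"
    using bump_ge by blast
  \<comment> \<open>By \<open>bump_ge\<close> a slope of this size contributes at least (|B| + 4) x
    (1 - x): |B| absorbs the remainder, and 4 leaves a shift by 1 at x = 1/2, enough to push the
    chord value, which lies in (0,1), past 0 or 1.\<close>
  define P where "P = (\<bar>B\<bar> + 4) * vs 1 / k"
  have P: "P > 0" using vs_1_pos k by (simp add: P_def)
  have Pk: "(\<bar>B\<bar> + 4) * (x * (1 - x)) \<le> P * (sn x * vs 1 - sn 1 * vs x) / vs 1" if x: "x \<in> {0..1}" for x
  proof -
    have "(\<bar>B\<bar> + 4) * (x * (1 - x)) = P * (k * (x * (1 - x))) / vs 1"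
      using k vs_1_pos by (simp add: P_def)
    also have "\<dots> \<le> P * (sn x * vs 1 - sn 1 * vs x) / vs 1"
      using k(2)[OF x] P vs_1_pos by (intro divide_right_mono mult_left_mono) auto
    finally show ?thesis .
  qed
  have xx: "0 \<le> x * (1 - x)" if "x \<in> {0..1}" for x :: real using that by simp
  have Bx: "B * (x * (1 - x)) \<le> \<bar>B\<bar> * (x * (1 - x))" if "x \<in> {0..1}" for x
    using xx[OF that] by (intro mult_right_mono) auto
  have lo: "U (- P) x \<le> (1 - x) * a + x * b - 4 * (x * (1 - x))" if x: "x \<in> {0..1}" for x
  proof -
    from B[of "- P"] obtain R where "U (- P) x = - (P * (sn x * vs 1 - sn 1 * vs x) / vs 1) + R x"
      "\<bar>R x - ((1 - x) * a + x * b)\<bar> \<le> B * (x * (1 - x))" using x by auto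
    then show ?thesis using Pk[OF x] Bx[OF x] unfolding distrib_right by linarith
  qed
  have hi: "(1 - x) * a + x * b + 4 * (x * (1 - x)) \<le> U P x" if x: "x \<in> {0..1}" for x
  proof -
    from B[of P] obtain R where "U P x = P * (sn x * vs 1 - sn 1 * vs x) / vs 1 + R x"
      "\<bar>R x - ((1 - x) * a + x * b)\<bar> \<le> B * (x * (1 - x))" using x by auto
    then show ?thesis using Pk[OF x] Bx[OF x] unfolding distrib_right by linarith
  qed
  have "U (- P) x < 1" if x: "x \<in> {0..1}" for x
  proof -
    have "(1 - x) * a + x * b \<le> (1 - x) * max a b + x * max a b"
      using x by (intro add_mono mult_left_mono) auto
    also have "\<dots> = max a b" by (simp add: algebra_simps)
    also have "\<dots> < 1" using a b by simp
    finally show ?thesis using lo[OF x] xx[OF x] by linarith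
  qed
  moreover have "U (- P) (1 / 2) \<le> 0" "1 \<le> U P (1 / 2)"
    using lo[of "1/2"] hi[of "1/2"] a b by auto
  ultimately show ?thesis using P by (intro exI[of _ "- P"] exI[of _ P]) auto
qed

section \<open>Orbits touching infinity or the horizon\<close>

lemma U_tendsto: "x \<in> {0..1} \<Longrightarrow> ((\<lambda>p. U p x) \<longlongrightarrow> U q x) (at q within S)"
proof -
  assume x: "x \<in> {0..1}"
  obtain M where M: "M > 0" "\<And>p q x. x \<in> {0..1} \<Longrightarrow> \<bar>U p x - U q x\<bar> \<le> M * \<bar>p - q\<bar>"
    using U_lipschitz by blast
  have "M-lipschitz_on UNIV (\<lambda>p. U p x)"
    using M x by (intro lipschitz_onI) (auto simp: dist_real_def)
  then have "continuous_on UNIV (\<lambda>p. U p x)" by (rule lipschitz_on_continuous_on)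
  then show ?thesis
    by (meson UNIV_I continuous_on tendsto_within_subset top_greatest)
qed

lemma shoot_tendsto: "(shoot \<longlongrightarrow> shoot q) (at q within S)"
  using continuous_on_shoot[of UNIV]
  by (meson UNIV_I continuous_on tendsto_within_subset top_greatest)

text \<open>The contact is tangential. If \<open>shoot r\<close> were nonpositive, then u'' <= 3 w^2
  u <= (2 w)^2 u to the right of it, and comparison would keep u at or below 0 up to x = 1, where it
  equals \<open>b > 0\<close>.\<close>

lemma shoot_pos_if_touches_0:
  assumes nonneg: "\<And>z. z \<in> {0..1} \<Longrightarrow> 0 \<le> U r z" and x: "x \<in> {0..1}" "U r x = 0"
  shows "0 < shoot r"
proof (rule ccontr)
  assume neg: "\<not> 0 < shoot r"
  have x01: "0 < x" "x < 1" using x a b by (cases "x = 0"; cases "x = 1"; auto)+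
  have s: "{x..1} \<subseteq> {0..1}" using x01 by auto
  have "V r x = 0"
    using deriv_eq_0_at_min[OF U_deriv[OF x(1)] x01] nonneg x by simp
  then have "U r 1 \<le> 0"
  proof (intro second_order_comparison[where f = "U r" and f' = "V r" and a = x and b = 1 and k = "2 * w"
      and f'' = "\<lambda>z. shoot r - w\<^sup>2 * U r z + w\<^sup>2 * bend (U r z)"])
    fix z assume z: "z \<in> {x..1}"
    then have z1: "z \<in> {0..1}" using s by blast
    show "(U r has_real_derivative V r z) (at z within {x..1})"
      "(V r has_real_derivative shoot r - w\<^sup>2 * U r z + w\<^sup>2 * bend (U r z)) (at z within {x..1})"
      by (rule DERIV_subset[OF U_deriv[OF z1] s] DERIV_subset[OF V_deriv[OF z1] s])+
    have "bend (U r z) - bend 0 \<le> 3 * (U r z - 0)"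
      by (intro bend_lipschitz_le nonneg z1)
    then have "w\<^sup>2 * bend (U r z) \<le> w\<^sup>2 * (3 * U r z)"
      by (intro mult_left_mono) (auto simp: bend_eq)
    moreover have "w\<^sup>2 * U r z \<ge> 0" using nonneg[OF z1] by simp
    ultimately show "shoot r - w\<^sup>2 * U r z + w\<^sup>2 * bend (U r z) \<le> (2 * w)\<^sup>2 * U r z"
      using neg by (simp add: power_mult_distrib)
  qed (use x x01 in auto)
  then show False using b by simp
qed

lemma sn_pos: "0 < x \<Longrightarrow> x < 1 \<Longrightarrow> 0 < sn x"
proof -
  assume x: "0 < x" "x < 1"
  have "w * x < pi" if "w > 0"
    using x w that mult_strict_left_mono[of x 1 w] by linarith
  then show ?thesis using x w by (auto simp: sn_def intro!: divide_pos_pos sin_gt_zero)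
qed

text \<open>Where \<open>U r\<close> is negative it satisfies \<open>u'' + w\<^sup>2 u = shoot r\<close>; for \<open>shoot r < 0\<close> a Sturm
  comparison with \<open>sn\<close> shows that it could not return to 0 within an angle \<open>w \<le> \<pi>\<close>.\<close>

lemma U_pos_if_shoot_neg:
  assumes neg: "shoot r < 0" and z: "z \<in> {0..1}"
  shows "0 < U r z"
proof (rule ccontr)
  assume "\<not> 0 < U r z"
  obtain x where x: "x \<in> {0..1}" "\<And>y. y \<in> {0..1} \<Longrightarrow> U r x \<le> U r y"
    using continuous_attains_inf[OF compact_Icc _ continuous_on_U] by fastforce
  have "U r x \<le> 0" using x(2)[OF z] \<open>\<not> 0 < U r z\<close> by simp
  moreover have "U r x \<noteq> 0" using shoot_pos_if_touches_0[of r x] x neg by force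
  ultimately have Ux: "U r x < 0" by simp
  have x01: "0 < x" "x < 1" using x Ux a b by (cases "x = 0"; cases "x = 1"; auto)+
  have cont: "continuous_on {s..t} (U r)" if "0 \<le> s" "t \<le> 1" for s t
    by (rule continuous_on_subset[OF continuous_on_U]) (use that in auto)
  obtain x1 where x1: "0 \<le> x1" "x1 < x" "U r x1 = 0" "\<And>s. x1 < s \<Longrightarrow> s \<le> x \<Longrightarrow> U r s < 0"
  proof -
    have "compact ({0..x} \<inter> U r -` {0..})"
      using x01 by (intro compact_Int_closed[of "{0..x}" "{0..x} \<inter> U r -` {0..}", simplified]
          continuous_closed_preimage cont) auto
    moreover have "0 \<in> {0..x} \<inter> U r -` {0..}" using x01 a by auto
    ultimately obtain t where t: "t \<in> {0..x} \<inter> U r -` {0..}" "\<And>s. s \<in> {0..x} \<inter> U r -` {0..} \<Longrightarrow> s \<le> t"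
      using continuous_attains_sup[OF _ _ continuous_on_id] by (metis empty_iff)
    obtain s where s: "t \<le> s" "s \<le> x" "U r s = 0"
      using IVT2'[of "U r" x 0 t] t Ux cont[of t x] x01 by auto
    then have "s = t" using t(2)[of s] t(1) by auto
    with s have Ut: "U r t = 0" by simp
    then have "t \<noteq> x" using Ux by auto
    moreover have "U r s < 0" if "t < s" "s \<le> x" for s
      using t(2)[of s] t(1) that by (cases "U r s < 0") auto
    ultimately show ?thesis using t(1) by (intro that[of t] Ut) auto
  qed
  obtain x2 where x2: "x < x2" "x2 \<le> 1" "U r x2 = 0" "\<And>s. x \<le> s \<Longrightarrow> s < x2 \<Longrightarrow> U r s < 0"
  proof -
    have "compact ({x..1} \<inter> U r -` {0..})"
      using x01 by (intro compact_Int_closed[of "{x..1}" "{x..1} \<inter> U r -` {0..}", simplified]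
          continuous_closed_preimage cont) auto
    moreover have "1 \<in> {x..1} \<inter> U r -` {0..}" using x01 b by auto
    ultimately obtain t where t: "t \<in> {x..1} \<inter> U r -` {0..}" "\<And>s. s \<in> {x..1} \<inter> U r -` {0..} \<Longrightarrow> t \<le> s"
      using continuous_attains_inf[OF _ _ continuous_on_id] by (metis empty_iff)
    obtain s where s: "x \<le> s" "s \<le> t" "U r s = 0"
      using IVT'[of "U r" x 0 t] t Ux cont[of x t] x01 by auto
    then have "s = t" using t(2)[of s] t(1) by auto
    with s have Ut: "U r t = 0" by simp
    then have "t \<noteq> x" using Ux by auto
    moreover have "U r s < 0" if "x \<le> s" "s < t" for s
      using t(2)[of s] t(1) that by (cases "U r s < 0") auto
    ultimately show ?thesis using t(1) by (intro that[of t] Ut) auto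
  qed
  \<comment> \<open>Strict because the end values \<open>a\<close> and \<open>b\<close> are not
    zero; this keeps \<open>sn\<close> positive on the whole stretch even for
    \<open>w = pi\<close>.\<close>
  have l: "x2 - x1 < 1"
    using x1 x2 a b by (cases "x1 = 0"; cases "x2 = 1"; auto)
  \<comment> \<open>The Wronskian of \<open>U r\<close> with sn (s - x1). Its derivative is shoot r
    * sn (s - x1) < 0 and it starts at 0, whereas U = 0 and V >= 0 at \<open>x2\<close> make it
    nonnegative there.\<close>
  define j where "j s = V r s * sn (s - x1) - U r s * cos (w * (s - x1))" for s
  have c: "continuous_on {x1..x2} j"
  proof -
    have "continuous_on {0..1} (V r)" "continuous_on {0..1} (U r)"
      by (rule DERIV_continuous_on, erule V_deriv U_deriv)+
    then have "continuous_on {x1..x2} (V r)" "continuous_on {x1..x2} (U r)"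
      using x1(1) x2(2) by (auto intro: continuous_on_subset)
    then show ?thesis unfolding j_def by (intro continuous_intros)
  qed
  have "j x2 < j x1"
  proof (rule DERIV_neg_imp_decreasing_open[OF _ _ c])
    fix s assume s: "x1 < s" "s < x2"
    then have s1: "s \<in> {0..1}" "0 < s" "s < 1" using x1 x2 by auto
    have "U r s < 0" using x1(4)[of s] x2(4)[of s] s by (cases "s \<le> x") auto
    then have "bend (U r s) = 0" by (simp add: bend_def)
    then have "(V r has_real_derivative shoot r - w\<^sup>2 * U r s) (at s)" "(U r has_real_derivative V r s) (at s)"
      using V_deriv[OF s1(1), of r] U_deriv[OF s1(1), of r] s1 by (simp_all add: at_within_Icc_at)
    note D = this
    have C: "((\<lambda>s. cos (w * (s - x1))) has_real_derivative - w\<^sup>2 * sn (s - x1)) (at s)"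
      unfolding sn_def by (auto intro!: derivative_eq_intros simp: power2_eq_square)
    have "(j has_real_derivative shoot r * sn (s - x1)) (at s)"
      unfolding j_def[abs_def]
      by (rule DERIV_cong[OF DERIV_diff[OF DERIV_mult[OF D(1) sn_deriv[OF DERIV_diff[OF DERIV_ident DERIV_const]]]
          DERIV_mult[OF D(2) C]]]) (simp add: algebra_simps)
    moreover have "shoot r * sn (s - x1) < 0"
      using neg s l by (intro mult_neg_pos sn_pos) auto
    ultimately show "\<exists>y. (j has_real_derivative y) (at s) \<and> y < 0" by blast
  qed (use x1 x2 in auto)
  moreover have "0 \<le> V r x2"
  proof (rule ccontr)
    assume "\<not> 0 \<le> V r x2"
    then have "V r x2 < 0" by simp
    moreover have "x2 \<in> {0..1}" using x1 x2 by auto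
    ultimately obtain d where d: "d > 0" "\<And>h. h > 0 \<Longrightarrow> x2 - h \<in> {0..1} \<Longrightarrow> h < d \<Longrightarrow> U r x2 < U r (x2 - h)"
      using has_real_derivative_neg_dec_left[OF U_deriv] by metis
    define h where "h = min (d / 2) (x2 - x)"
    have "h > 0" "h < d" "x2 - h \<in> {0..1}" "x \<le> x2 - h" "x2 - h < x2"
      using d(1) x2(1,2) x01 by (auto simp: h_def min_def)
    then show False using d(2)[of h] x2(3) x2(4)[of "x2 - h"] by simp
  qed
  then have "0 \<le> j x2"
    using sn_pos[of "x2 - x1"] l x1 x2 by (simp add: j_def)
  ultimately show False by (simp add: j_def x1)
qed

text \<open>\<open>q\<close> is the least slope in [l,h] whose orbit reaches 1, and \<open>p\<close>
  the largest one in [l,q] whose orbit reaches 0. By continuity these limiting orbits still stay in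
  [0,1], so their contacts are tangential.\<close>

lemma ex_thresholds:
  obtains p q x y where "p < q" "x \<in> {0<..<1}" "y \<in> {0<..<1}" "U p x = 0" "V p x = 0" "U q y = 1" "V q y = 0"
    "\<And>r z. r \<in> {p..q} \<Longrightarrow> z \<in> {0..1} \<Longrightarrow> 0 \<le> U r z \<and> U r z \<le> 1"
    "\<And>r z. r \<in> {p<..<q} \<Longrightarrow> z \<in> {0..1} \<Longrightarrow> 0 < U r z \<and> U r z < 1"
    "0 < shoot p" "2 * shoot q + w\<^sup>2 < 0"
proof -
  obtain l h where lh: "l < h" "\<And>x. x \<in> {0..1} \<Longrightarrow> U l x < 1" "U l (1 / 2) \<le> 0" "1 \<le> U h (1 / 2)"
    using ex_extreme_slopes by blast
  \<comment> \<open>Contact sets of pairs (slope, parameter) are compact, so extreme slopes are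
    attained.\<close>
  have compact: "compact ({(r, z). r \<in> {s..t} \<and> z \<in> {0..1} \<and> U r z \<in> C})" if "closed C" for s t C
  proof -
    have "compact (({s..t} \<times> {0..1}) \<inter> (\<lambda>(r, z). U r z) -` C)"
      using continuous_closed_preimage[OF continuous_on_U_joint[of "{s..t}"] _ that]
      by (intro compact_Int_closed[of "{s..t} \<times> {0..1}" "({s..t} \<times> {0..1}) \<inter> (\<lambda>(r, z). U r z) -` C", simplified])
        (auto intro!: compact_Times closed_Times)
    moreover have "({s..t} \<times> {0..1}) \<inter> (\<lambda>(r, z). U r z) -` C = {(r, z). r \<in> {s..t} \<and> z \<in> {0..1} \<and> U r z \<in> C}"
      by auto
    ultimately show ?thesis by simp
  qed
  obtain q y where q: "q \<in> {l..h}" "y \<in> {0..1}" "U q y \<ge> 1"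
    and q_min: "\<And>r z. r \<in> {l..h} \<Longrightarrow> z \<in> {0..1} \<Longrightarrow> U r z \<ge> 1 \<Longrightarrow> q \<le> r"
  proof -
    let ?Q = "{(r, z). r \<in> {l..h} \<and> z \<in> {0..1} \<and> U r z \<in> {1..}}"
    have "(h, 1 / 2) \<in> ?Q" using lh by auto
    then have "?Q \<noteq> {}" by blast
    from continuous_attains_inf[OF compact this continuous_on_fst[OF continuous_on_id]]
    obtain s where "s \<in> ?Q" "\<forall>t\<in>?Q. fst s \<le> fst t" by auto
    then show ?thesis using that[of "fst s" "snd s"] by (auto simp: case_prod_beta)
  qed
  have lq: "l < q" using q lh(2)[of y] by (cases "l = q") auto
  have below: "U r z < 1" if "r \<in> {l..<q}" "z \<in> {0..1}" for r z
    using q_min[of r z] that q(1) by force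
  \<comment> \<open>Slopes below \<open>q\<close> give orbits below 1; pass to the limit from the
    left.\<close>
  have q_le: "U q z \<le> 1" if z: "z \<in> {0..1}" for z
  proof (rule tendsto_upperbound[OF U_tendsto[OF z, of q "{..<q}"]])
    have "\<forall>\<^sub>F r in at_left q. l < r" by (rule order_tendstoD(1)[OF tendsto_ident_at lq])
    moreover have "\<forall>\<^sub>F r in at_left q. r \<in> {..<q}" by (simp add: eventually_at_filter)
    ultimately show "\<forall>\<^sub>F r in at_left q. U r z \<le> 1"
      by eventually_elim (use below z in \<open>force intro: less_imp_le\<close>)
  qed simp
  obtain p x where p: "p \<in> {l..q}" "x \<in> {0..1}" "U p x \<le> 0"
    and p_max: "\<And>r z. r \<in> {l..q} \<Longrightarrow> z \<in> {0..1} \<Longrightarrow> U r z \<le> 0 \<Longrightarrow> r \<le> p"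
  proof -
    let ?Q = "{(r, z). r \<in> {l..q} \<and> z \<in> {0..1} \<and> U r z \<in> {..0}}"
    have "(l, 1 / 2) \<in> ?Q" using lh lq by auto
    then have "?Q \<noteq> {}" by blast
    from continuous_attains_sup[OF compact this continuous_on_fst[OF continuous_on_id]]
    obtain s where "s \<in> ?Q" "\<forall>t\<in>?Q. fst t \<le> fst s" by auto
    then show ?thesis using that[of "fst s" "snd s"] by (auto simp: case_prod_beta)
  qed
  have above: "0 < U r z" if "r \<in> {p<..q}" "z \<in> {0..1}" for r z
    using p_max[of r z] that p(1) by force
  have upper: "U r z \<le> 1" if "r \<in> {p..q}" "z \<in> {0..1}" for r z
    using below[of r z] q_le[of z] that p(1) by (cases "r = q") auto
  have U'': "(V r has_real_derivative shoot r - w\<^sup>2 * U r z + w\<^sup>2 * bend (U r z)) (at z within {t..1})"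
    "(U r has_real_derivative V r z) (at z within {t..1})"
    if "z \<in> {t..1}" "0 \<le> t" for r z t
    using DERIV_subset[OF V_deriv] DERIV_subset[OF U_deriv] that by auto
  \<comment> \<open>an orbit touching 1 from below with a nonnegative second derivative would stay at 1\<close>
  have y: "0 < y" "y < 1" using q a b by (cases "y = 0"; cases "y = 1"; auto)+
  have Uq: "U q y = 1" using q q_le[of y] by simp
  have Vq: "V q y = 0"
    using deriv_eq_0_at_max[OF U_deriv[OF q(2)] y] q_le Uq by simp
  have sq: "2 * shoot q + w\<^sup>2 < 0"
  proof (rule ccontr)
    assume neg: "\<not> 2 * shoot q + w\<^sup>2 < 0"
    have "1 - U q 1 \<le> 0"
    proof (rule second_order_comparison[where f = "\<lambda>z. 1 - U q z" and f' = "\<lambda>z. - V q z" and a = y and b = 1 and k = "2 * w"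
        and f'' = "\<lambda>z. - (shoot q - w\<^sup>2 * U q z + w\<^sup>2 * bend (U q z))"])
      fix z assume z: "z \<in> {y..1}"
      show "((\<lambda>z. 1 - U q z) has_real_derivative - V q z) (at z within {y..1})"
        using y by (auto intro!: derivative_eq_intros U''[OF z])
      show "((\<lambda>z. - V q z) has_real_derivative - (shoot q - w\<^sup>2 * U q z + w\<^sup>2 * bend (U q z))) (at z within {y..1})"
        using y by (auto intro!: derivative_eq_intros U''[OF z])
      have "bend 1 - bend (U q z) \<le> 3 * (1 - U q z)"
        using z y by (intro bend_lipschitz_le q_le) auto
      then have "w\<^sup>2 * (U q z - bend (U q z) - 1 + bend 1) \<le> w\<^sup>2 * (2 * (1 - U q z))"
        by (intro mult_left_mono) auto
      moreover have "w\<^sup>2 * (1 - U q z) \<ge> 0" using q_le[of z] z y by (intro mult_nonneg_nonneg) auto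
      ultimately show "- (shoot q - w\<^sup>2 * U q z + w\<^sup>2 * bend (U q z)) \<le> (2 * w)\<^sup>2 * (1 - U q z)"
        using neg by (simp add: bend_eq algebra_simps power_mult_distrib)
    qed (use y Uq Vq in auto)
    then show False using b by simp
  qed
  \<comment> \<open>The orbit of slope \<open>q\<close> has negative A and is therefore positive
    throughout, so it cannot be the one reaching 0.\<close>
  have pq: "p < q"
    using U_pos_if_shoot_neg[of q x] sq p zero_le_power2[of w] by (cases "p = q") auto
  have lower: "0 \<le> U r z" if r: "r \<in> {p..q}" and z: "z \<in> {0..1}" for r z
  proof (cases "r = p")
    case True
    show ?thesis unfolding True
    proof (rule tendsto_lowerbound[OF U_tendsto[OF z, of p "{p<..}"]])
      have "\<forall>\<^sub>F r in at_right p. r < q" by (rule order_tendstoD(2)[OF tendsto_ident_at pq])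
      moreover have "\<forall>\<^sub>F r in at_right p. r \<in> {p<..}" by (simp add: eventually_at_filter)
      ultimately show "\<forall>\<^sub>F r in at_right p. 0 \<le> U r z"
        by eventually_elim (use above z in \<open>force intro: less_imp_le\<close>)
    qed simp
  qed (use above[OF _ z, of r] r in auto)
  have Up: "U p x = 0" using p lower[of p x] pq by simp
  have x: "0 < x" "x < 1" using p(2) Up a b by (cases "x = 0"; cases "x = 1"; auto)+
  have Vp: "V p x = 0"
    using deriv_eq_0_at_min[OF U_deriv[OF p(2)] x] lower[of p] Up pq by simp
  have sp: "0 < shoot p"
    using shoot_pos_if_touches_0[OF _ p(2) Up] lower[of p] pq by simp
  show ?thesis
  proof (rule that[OF pq _ _ Up Vp Uq Vq _ _ sp sq])
    show "x \<in> {0<..<1}" "y \<in> {0<..<1}" using x y by auto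
    show "0 \<le> U r z \<and> U r z \<le> 1" if "r \<in> {p..q}" "z \<in> {0..1}" for r z
      using lower upper that by blast
    show "0 < U r z \<and> U r z < 1" if "r \<in> {p<..<q}" "z \<in> {0..1}" for r z
      using above[of r z] below[of r z] that p(1) by auto
  qed
qed

subsection \<open>Energy and elapsed time\<close>

text \<open>The conserved quantity read off at x = 0, where U = a and V = p. It may be negative, in
  which case the orbit carries no real E.\<close>

definition energy :: "real \<Rightarrow> real" where
  "energy p = p\<^sup>2 + (1 - a) * (2 * shoot p + w\<^sup>2 * a\<^sup>2)"

text \<open>The range condition makes \<open>bend\<close> the true quadratic term; only then is the
  quantity conserved.\<close>

lemma energy_eq:
  assumes range: "\<And>x. x \<in> {0..1} \<Longrightarrow> 0 \<le> U p x \<and> U p x \<le> 1" and x: "x \<in> {0..1}"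
  shows "(V p x)\<^sup>2 + (1 - U p x) * (2 * shoot p + w\<^sup>2 * (U p x)\<^sup>2) = energy p"
proof -
  define e where "e x = (V p x)\<^sup>2 + (1 - U p x) * (2 * shoot p + w\<^sup>2 * (U p x)\<^sup>2)" for x
  have "\<exists>c. \<forall>x\<in>{0..1}. e x = c"
  proof (rule has_field_derivative_zero_constant)
    fix x :: real assume x: "x \<in> {0..1}"
    have "bend (U p x) = 3 / 2 * (U p x)\<^sup>2" using range[OF x] by (simp add: bend_eq)
    then show "(e has_real_derivative 0) (at x within {0..1})"
      unfolding e_def[abs_def]
      by (auto intro!: derivative_eq_intros U_deriv[OF x] V_deriv[OF x]) (simp add: algebra_simps power2_eq_square)
  qed simp
  then have "e x = e 0" using x by auto
  then show ?thesis by (simp add: e_def energy_def)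
qed

definition lapse :: "real \<Rightarrow> real" where
  "lapse p = integral {0..1} (\<lambda>x. 1 / ((U p x)\<^sup>2 * (1 - U p x)))"

text \<open>The intermediate value theorem is applied to energy * lapse^2, which is defined and
  continuous also where the energy is negative; the root is taken only at the slope found.\<close>

lemma ex_orbit_lapse:
  assumes T: "0 \<le> T"
  shows "\<exists>p. (\<forall>x\<in>{0..1}. 0 < U p x \<and> U p x < 1) \<and> 0 \<le> energy p \<and> sqrt (energy p) * lapse p = T"
proof -
  obtain p q x y where pq: "p < q" and x: "x \<in> {0<..<1}" and y: "y \<in> {0<..<1}"
    and Up: "U p x = 0" and Vp: "V p x = 0" and Uq: "U q y = 1" and Vq: "V q y = 0"
    and weak: "\<And>r z. r \<in> {p..q} \<Longrightarrow> z \<in> {0..1} \<Longrightarrow> 0 \<le> U r z \<and> U r z \<le> 1"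
    and strict: "\<And>r z. r \<in> {p<..<q} \<Longrightarrow> z \<in> {0..1} \<Longrightarrow> 0 < U r z \<and> U r z < 1"
    and sp: "0 < shoot p" and sq: "2 * shoot q + w\<^sup>2 < 0"
    by (rule ex_thresholds) (rule that; assumption)
  \<comment> \<open>At \<open>q\<close> itself the energy is 0 and the lapse integrand is unbounded,
    so a slope slightly below \<open>q\<close> is used. There V = 0 at an interior maximum, and the
    energy read off at it is (1 - U) (2 A + w^2 U^2) < 0.\<close>
  obtain p1 where p1: "p < p1" "p1 < q" "energy p1 < 0"
  proof -
    have "((\<lambda>r. 2 * shoot r + w\<^sup>2) \<longlongrightarrow> 2 * shoot q + w\<^sup>2) (at_left q)"
      by (intro tendsto_intros shoot_tendsto)
    then have "\<forall>\<^sub>F r in at_left q. 2 * shoot r + w\<^sup>2 < 0" using sq by (rule order_tendstoD(2))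
    \<comment> \<open>A value above both boundary values forces the maximum into the
      interior.\<close>
    moreover have "\<forall>\<^sub>F r in at_left q. max a b < U r y"
      by (rule order_tendstoD(1)[OF U_tendsto]) (use y Uq a b in auto)
    moreover have "\<forall>\<^sub>F r in at_left q. p < r" by (rule order_tendstoD(1)[OF tendsto_ident_at pq])
    moreover have "\<forall>\<^sub>F r in at_left q. r < q" by (simp add: eventually_at_filter)
    ultimately have "\<forall>\<^sub>F r in at_left q. p < r \<and> r < q \<and> 2 * shoot r + w\<^sup>2 < 0 \<and> max a b < U r y"
      by eventually_elim simp
    then obtain r where r: "p < r" "r < q" "2 * shoot r + w\<^sup>2 < 0" "max a b < U r y"
      using eventually_happens'[OF trivial_limit_at_left_real] by blast
    obtain z where z: "z \<in> {0..1}" "\<And>t. t \<in> {0..1} \<Longrightarrow> U r t \<le> U r z"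
      using continuous_attains_sup[OF compact_Icc _ continuous_on_U[of r]] by fastforce
    have "max a b < U r z" using r(4) z(2)[of y] y by auto
    then have z01: "0 < z" "z < 1" using z(1) by (cases "z = 0"; cases "z = 1"; auto)+
    have "V r z = 0" using deriv_eq_0_at_max[OF U_deriv[OF z(1)] z01 z(2)] .
    then have e: "energy r = (1 - U r z) * (2 * shoot r + w\<^sup>2 * (U r z)\<^sup>2)"
      using energy_eq[of r z] weak[of r] r z(1) by simp
    have U01: "0 < U r z" "U r z < 1" using strict[of r z] r z(1) by auto
    then have "w\<^sup>2 * (U r z)\<^sup>2 \<le> w\<^sup>2 * 1" by (intro mult_left_mono power_le_one) auto
    then have "energy r < 0" unfolding e using r(3) U01 by (intro mult_pos_neg) auto
    then show ?thesis using that r by blast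
  qed
  have Ep: "energy p = 2 * shoot p"
    using energy_eq[of p x] weak[of p] x pq Up Vp by simp
  obtain M where M: "M > 0" "\<And>p q x. x \<in> {0..1} \<Longrightarrow> \<bar>U p x - U q x\<bar> \<le> M * \<bar>p - q\<bar>"
    using U_lipschitz by blast
  \<comment> \<open>the double zero of \<open>U p\<close> at \<open>x\<close> makes the lapse blow up\<close>
  define B where "B = shoot p + 3 / 2 * w\<^sup>2"
  have B: "B > 0" using sp by (simp add: B_def add_pos_nonneg)
  \<comment> \<open>\<open>B\<close> bounds the second derivative of \<open>U p\<close>, because U
    >= 0 and bend <= 3/2; the comparison parabola has second derivative \<open>B\<close>.\<close>
  have quad: "U p z \<le> B / 2 * (z - x)\<^sup>2" if z: "x \<le> z" "z \<le> 1" for z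
  proof -
    have s: "{x..z} \<subseteq> {0..1}" using x z by auto
    have "U p z - B / 2 * (z - x)\<^sup>2 \<le> 0"
    proof (rule second_order_comparison[where f = "\<lambda>z. U p z - B / 2 * (z - x)\<^sup>2" and a = x and b = z and k = 0
        and f' = "\<lambda>z. V p z - B * (z - x)" and f'' = "\<lambda>z. shoot p - w\<^sup>2 * U p z + w\<^sup>2 * bend (U p z) - B"])
      fix t assume "t \<in> {x..z}"
      then have t: "t \<in> {0..1}" using s by blast
      note D = DERIV_subset[OF U_deriv[OF t, of p] s] DERIV_subset[OF V_deriv[OF t, of p] s]
      show "((\<lambda>z. U p z - B / 2 * (z - x)\<^sup>2) has_real_derivative V p t - B * (t - x)) (at t within {x..z})"
        "((\<lambda>z. V p z - B * (z - x)) has_real_derivative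
          shoot p - w\<^sup>2 * U p t + w\<^sup>2 * bend (U p t) - B) (at t within {x..z})"
        by (auto intro!: derivative_eq_intros D)
      have "w\<^sup>2 * bend (U p t) \<le> w\<^sup>2 * (3 / 2)"
        using bend_range by (intro mult_left_mono) auto
      moreover have "0 \<le> w\<^sup>2 * U p t" using weak[of p t] pq t by simp
      ultimately show "shoot p - w\<^sup>2 * U p t + w\<^sup>2 * bend (U p t) - B
          \<le> 0\<^sup>2 * (U p t - B / 2 * (t - x)\<^sup>2)"
        by (simp add: B_def)
    qed (use z Up Vp in auto)
    then show ?thesis by simp
  qed
  have nz: "(U r z)\<^sup>2 * (1 - U r z) \<noteq> 0" if "r \<in> {p<..<q}" "z \<in> {0..1}" for r z
    using strict[OF that] by simp
  have integrable: "(\<lambda>z. 1 / ((U r z)\<^sup>2 * (1 - U r z))) integrable_on {s..t}"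
    if "r \<in> {p<..<q}" "0 \<le> s" "t \<le> 1" for r s t
    using that(2,3) nz[OF that(1)]
    by (intro integrable_continuous_real continuous_intros continuous_on_subset[OF continuous_on_U]) auto
  \<comment> \<open>On [x, x + d] the orbit of slope \<open>r\<close> is at most B d^2, half from
    the parabola and half from the Lipschitz bound. The integrand is thus at least 1 / (B^2 d^4) on
    a length \<open>d\<close>.\<close>
  have lapse_ge: "1 / (B\<^sup>2 * d ^ 3) \<le> lapse r"
    if d: "0 < d" "x + d \<le> 1" and r: "p < r" "r < q" "M * (r - p) \<le> B / 2 * d\<^sup>2" for d r
  proof -
    have rr: "r \<in> {p<..<q}" using r by simp
    have pos: "0 \<le> 1 / ((U r z)\<^sup>2 * (1 - U r z))" if "z \<in> {0..1}" for z
      using strict[OF rr that] by simp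
    have ge: "1 / (B\<^sup>2 * d ^ 4) \<le> 1 / ((U r z)\<^sup>2 * (1 - U r z))" if z: "z \<in> {x..x + d}" for z
    proof -
      have z01: "z \<in> {0..1}" using z d x by auto
      have "U r z \<le> U p z + M * (r - p)" using M(2)[OF z01, of r p] r by simp
      also have "U p z \<le> B / 2 * (z - x)\<^sup>2" using quad[of z] z d by simp
      also have "\<dots> \<le> B / 2 * d\<^sup>2" using z B by (intro mult_left_mono power_mono) auto
      finally have "U r z \<le> B * d\<^sup>2" using r by simp
      then have "(U r z)\<^sup>2 \<le> (B * d\<^sup>2)\<^sup>2" using strict[OF rr z01] by (intro power_mono) auto
      also have "\<dots> = B\<^sup>2 * d ^ 4" by (simp add: power_mult_distrib)
      finally have "(U r z)\<^sup>2 * (1 - U r z) \<le> B\<^sup>2 * d ^ 4 * 1"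
        using strict[OF rr z01] by (intro mult_mono) auto
      then show ?thesis using strict[OF rr z01] B d by (intro divide_left_mono mult_pos_pos) auto
    qed
    have "1 / (B\<^sup>2 * d ^ 3) = integral {x..x + d} (\<lambda>z. 1 / (B\<^sup>2 * d ^ 4))"
      using d by (simp add: power4_eq_xxxx power3_eq_cube)
    also have "\<dots> \<le> integral {x..x + d} (\<lambda>z. 1 / ((U r z)\<^sup>2 * (1 - U r z)))"
      using x d by (intro integral_le integrable rr ge) auto
    also have "\<dots> \<le> lapse r"
      unfolding lapse_def using x d pos by (intro integral_subset_le integrable rr) auto
    finally show ?thesis .
  qed
  obtain p0 where p0: "p < p0" "p0 < p1" "T\<^sup>2 \<le> energy p0 * (lapse p0)\<^sup>2"
  proof -
    \<comment> \<open>Near \<open>p\<close> the energy exceeds \<open>shoot p\<close>, half of its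
      limit, so a lapse of at least \<open>N\<close> suffices.\<close>
    define N where "N = T / sqrt (shoot p)"
    have N: "0 \<le> N" "shoot p * N\<^sup>2 = T\<^sup>2" using T sp by (auto simp: N_def power_divide)
    \<comment> \<open>Since d <= 1, B^2 d^3 N <= B^2 d (N + 1) <= 1.\<close>
    define d where "d = min (1 - x) (1 / (B\<^sup>2 * (N + 1)))"
    have d: "0 < d" "x + d \<le> 1" "d \<le> 1" using x B N by (auto simp: d_def)
    have "N \<le> 1 / (B\<^sup>2 * d ^ 3)"
    proof -
      have "B\<^sup>2 * d ^ 3 * N \<le> B\<^sup>2 * d * (N + 1)"
        using d N power_decreasing[of 1 3 d] B by (intro mult_mono) auto
      also have "\<dots> \<le> B\<^sup>2 * (1 / (B\<^sup>2 * (N + 1))) * (N + 1)"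
        using B N by (intro mult_left_mono mult_right_mono) (auto simp: d_def)
      also have "\<dots> = 1"
      proof -
        have "N + 1 \<noteq> 0" using N by simp
        then show ?thesis using B by simp
      qed
      finally show ?thesis using B d by (simp add: field_simps)
    qed
    note Nd = this
    have "(energy \<longlongrightarrow> energy p) (at_right p)"
      unfolding energy_def[abs_def] by (intro tendsto_intros shoot_tendsto)
    then have "\<forall>\<^sub>F r in at_right p. shoot p < energy r"
      by (rule order_tendstoD(1)) (use Ep sp in simp)
    moreover have "((\<lambda>r. M * (r - p)) \<longlongrightarrow> M * (p - p)) (at_right p)"
      by (intro tendsto_intros)
    then have "\<forall>\<^sub>F r in at_right p. M * (r - p) < B / 2 * d\<^sup>2"
      by (rule order_tendstoD(2)) (use B d in simp)
    moreover have "\<forall>\<^sub>F r in at_right p. r < p1" by (rule order_tendstoD(2)[OF tendsto_ident_at p1(1)])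
    moreover have "\<forall>\<^sub>F r in at_right p. p < r" by (simp add: eventually_at_filter)
    ultimately have "\<forall>\<^sub>F r in at_right p. p < r \<and> r < p1 \<and> shoot p < energy r \<and> M * (r - p) < B / 2 * d\<^sup>2"
      by eventually_elim simp
    then obtain r where r: "p < r" "r < p1" "shoot p < energy r" "M * (r - p) < B / 2 * d\<^sup>2"
      using eventually_happens'[OF trivial_limit_at_right_real] by blast
    have "N \<le> lapse r" using Nd lapse_ge[OF d(1,2) r(1)] r p1 by simp
    then have "shoot p * N\<^sup>2 \<le> energy r * (lapse r)\<^sup>2"
      using N r sp by (intro mult_mono power_mono) auto
    then show ?thesis using that r N by simp
  qed
  have mem: "r \<in> {p<..<q}" if "r \<in> {p0..p1}" for r using that p0 p1 by auto
  have "continuous_on {p0..p1} lapse"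
    unfolding lapse_def[abs_def]
  proof (rule integral_continuous_on_param[of _ 0 "1 :: real", simplified])
    have "continuous_on ({p0..p1} \<times> {0..1}) (\<lambda>z. U (fst z) (snd z))"
      using continuous_on_U_joint[of "{p0..p1}"] by (simp add: case_prod_beta)
    then show "continuous_on ({p0..p1} \<times> {0..1}) (\<lambda>(r, z). 1 / ((U r z)\<^sup>2 * (1 - U r z)))"
      unfolding case_prod_beta using nz[OF mem] by (intro continuous_intros) auto
  qed
  then have cont: "continuous_on {p0..p1} (\<lambda>r. energy r * (lapse r)\<^sup>2)"
    unfolding energy_def by (intro continuous_intros continuous_on_shoot)
  have "energy p1 * (lapse p1)\<^sup>2 \<le> T\<^sup>2"
    using p1(3) by (intro order_trans[OF mult_nonpos_nonneg zero_le_power2]) auto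
  then obtain r where r: "p0 \<le> r" "r \<le> p1" "energy r * (lapse r)\<^sup>2 = T\<^sup>2"
    using IVT2'[OF _ p0(3) _ cont] p0(2) by auto
  have rr: "r \<in> {p<..<q}" using mem r by simp
  have "0 < lapse r"
  proof -
    have "1 \<le> 1 / ((U r z)\<^sup>2 * (1 - U r z))" if "z \<in> {0..1}" for z
    proof -
      have "(U r z)\<^sup>2 * (1 - U r z) \<le> 1 * 1"
        using strict[OF rr that] by (intro mult_mono power_le_one) auto
      then show ?thesis using strict[OF rr that] by simp
    qed
    then have "integral {0..1::real} (\<lambda>z. 1) \<le> lapse r"
      unfolding lapse_def by (intro integral_le integrable rr) auto
    then show ?thesis by simp
  qed
  moreover have "energy r = (T / lapse r)\<^sup>2"
    using r(3) \<open>0 < lapse r\<close> by (simp add: power_divide field_simps)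
  ultimately show ?thesis
    using T strict[OF rr] by (intro exI[of _ r]) auto
qed

end

text \<open>The orbit found stays in (0,1), so \<open>bend\<close> is the true quadratic term.
  \<open>T\<close> may have any sign, and E takes its sign.\<close>

lemma ex_orbit:
  assumes "0 \<le> w" "w \<le> pi" "0 < a" "a < 1" "0 < b" "b < (1 :: real)"
  obtains A E :: real and u v :: "real \<Rightarrow> real"
  where "\<And>x. x \<in> {0..1} \<Longrightarrow> (u has_real_derivative v x) (at x within {0..1})"
    and "\<And>x. x \<in> {0..1} \<Longrightarrow>
      (v has_real_derivative A - w\<^sup>2 * u x + 3 / 2 * w\<^sup>2 * (u x)\<^sup>2) (at x within {0..1})"
    and "\<And>x. x \<in> {0..1} \<Longrightarrow> 0 < u x \<and> u x < 1"
    and "u 0 = a" and "u 1 = b"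
    and "\<And>x. x \<in> {0..1} \<Longrightarrow> (v x)\<^sup>2 + (1 - u x) * (2 * A + w\<^sup>2 * (u x)\<^sup>2) = E\<^sup>2"
    and "E * integral {0..1} (\<lambda>x. 1 / ((u x)\<^sup>2 * (1 - u x))) = T"
proof -
  interpret orbit_equation w a b by unfold_locales (use assms in auto)
  obtain p where "\<forall>x\<in>{0..1}. 0 < U p x \<and> U p x < 1" and p': "0 \<le> energy p"
    "sqrt (energy p) * lapse p = \<bar>T\<bar>"
    using ex_orbit_lapse[of "\<bar>T\<bar>"] by auto
  then have p: "0 < U p x \<and> U p x < 1" if "x \<in> {0..1}" for x using that by blast
  define E where "E = (if T < 0 then - 1 else 1) * sqrt (energy p)"
  have E: "E\<^sup>2 = energy p" "E * lapse p = T"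
    using p' by (auto simp: E_def power_mult_distrib)
  show ?thesis
  proof (rule that[of "U p" "V p" "shoot p" E])
    fix x :: real assume x: "x \<in> {0..1}"
    show "(U p has_real_derivative V p x) (at x within {0..1})" by (rule U_deriv[OF x])
    have "bend (U p x) = 3 / 2 * (U p x)\<^sup>2" using p[OF x] by (simp add: bend_eq)
    then show "(V p has_real_derivative shoot p - w\<^sup>2 * U p x + 3 / 2 * w\<^sup>2 * (U p x)\<^sup>2) (at x within {0..1})"
      using V_deriv[OF x, of p] by (simp only: mult.left_commute mult.assoc)
    show "(V p x)\<^sup>2 + (1 - U p x) * (2 * shoot p + w\<^sup>2 * (U p x)\<^sup>2) = E\<^sup>2"
      unfolding E using p by (intro energy_eq x) (auto simp: less_imp_le)
  qed (use p E in \<open>auto simp: lapse_def\<close>)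
qed

section \<open>Geodesics of the Schwarzschild metric\<close>

lemma frechet_derivative_eq_line:
  fixes f :: "'a::real_normed_vector \<Rightarrow> real"
  assumes f: "f differentiable (at p)"
    and line: "((\<lambda>s. f (p + s *\<^sub>R u)) has_real_derivative D) (at 0)"
  shows "frechet_derivative f (at p) u = D"
proof -
  have "((\<lambda>s. p + s *\<^sub>R u) has_derivative (\<lambda>s. s *\<^sub>R u)) (at 0)"
    by (auto intro!: derivative_eq_intros)
  moreover have "(f has_derivative frechet_derivative f (at p)) (at (p + 0 *\<^sub>R u))"
    using f by (simp add: frechet_derivative_works)
  ultimately have "((\<lambda>s. f (p + s *\<^sub>R u)) has_derivative (\<lambda>s. frechet_derivative f (at p) (s *\<^sub>R u))) (at 0)"
    by (rule has_derivative_compose)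
  also have "(\<lambda>s. frechet_derivative f (at p) (s *\<^sub>R u)) = (*) (frechet_derivative f (at p) u)"
    using linear_frechet_derivative[OF f] by (auto simp: linear_scale mult.commute)
  finally have "((\<lambda>s. f (p + s *\<^sub>R u)) has_real_derivative frechet_derivative f (at p) u) (at 0)"
    by (simp add: has_field_derivative_def)
  then show ?thesis using line by (rule DERIV_unique)
qed

text \<open>Since r/(r - 2m) - 1 = 2m/(r - 2m), the spatial part is the Euclidean product plus a
  multiple of the square of x, a form that is easier to differentiate.\<close>

lemma schwarzschild_metric_eq:
  assumes "2 * m < norm (snd p)" "0 < m"
  shows "schwarzschild_metric m p v z =
    - (1 - 2 * m / norm (snd p)) * (fst v * fst z) + snd v \<bullet> snd z
    + 2 * m / ((norm (snd p))\<^sup>2 * (norm (snd p) - 2 * m)) * ((snd p \<bullet> snd v) * (snd p \<bullet> snd z))"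
proof -
  define r where "r = norm (snd p)"
  have r: "r > 2 * m" "r > 0" using assms by (auto simp: r_def)
  show ?thesis
    unfolding schwarzschild_metric_def Let_def r_def[symmetric]
    using r by (simp add: field_simps power2_eq_square)
qed

text \<open>Along a line the three terms come from differentiating 2m/r, the coefficient 2m/(r^2 (r
  - 2m)), and the product of the two scalar products with x.\<close>

lemma metric_deriv_schwarzschild:
  fixes m :: real and p u v z :: "real \<times> (real ^ 3)"
  assumes m: "m > 0" and p: "p \<in> schwarzschild_spacetime m"
  defines "x \<equiv> snd p" and "r \<equiv> norm (snd p)"
  shows "metric_deriv (schwarzschild_metric m) p u v z =
    - (2 * m / r ^ 3) * (x \<bullet> snd u) * (fst v * fst z)
    - (2 * m * (3 * r - 2 * (2 * m)) / (r ^ 4 * (r - 2 * m)\<^sup>2)) * (x \<bullet> snd u) * ((x \<bullet> snd v) * (x \<bullet> snd z))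
    + 2 * m / (r\<^sup>2 * (r - 2 * m)) * ((snd u \<bullet> snd v) * (x \<bullet> snd z) + (x \<bullet> snd v) * (snd u \<bullet> snd z))"
    (is "_ = ?D")
  unfolding metric_deriv_def
proof (rule frechet_derivative_eq_line)
  show "(\<lambda>y. schwarzschild_metric m y v z) differentiable at p"
    by (rule schwarzschild_metric_differentiable[OF m p])
  have r: "r > 2 * m" "r > 0" "x \<noteq> 0" using p m by (auto simp: r_def x_def schwarzschild_spacetime_def)
  define N where "N s = norm (x + s *\<^sub>R snd u)" for s
  have N0: "N 0 = r" by (simp add: N_def r_def x_def)
  have N: "(N has_real_derivative (x \<bullet> snd u) / r) (at 0)"
  proof -
    have "((\<lambda>s. x + s *\<^sub>R snd u) has_derivative (\<lambda>s. s *\<^sub>R snd u)) (at 0)"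
      by (auto intro!: derivative_eq_intros)
    moreover have "(norm has_derivative (\<lambda>h. h \<bullet> sgn (x + 0 *\<^sub>R snd u))) (at (x + 0 *\<^sub>R snd u))"
      using r by (intro has_derivative_norm) simp
    ultimately have "((\<lambda>s. norm (x + s *\<^sub>R snd u)) has_derivative (\<lambda>s. (s *\<^sub>R snd u) \<bullet> sgn (x + 0 *\<^sub>R snd u))) (at 0)"
      by (rule has_derivative_compose)
    moreover have "(\<lambda>s. (s *\<^sub>R snd u) \<bullet> sgn (x + 0 *\<^sub>R snd u)) = (*) ((x \<bullet> snd u) / r)"
      by (auto simp: sgn_div_norm r_def x_def inner_commute field_simps)
    ultimately show ?thesis by (simp add: has_field_derivative_def N_def[abs_def])
  qed
  define h where "h s = - (1 - 2 * m / N s) * (fst v * fst z) + snd v \<bullet> snd z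
    + 2 * m / ((N s)\<^sup>2 * (N s - 2 * m)) * ((x \<bullet> snd v + s * (snd u \<bullet> snd v)) * (x \<bullet> snd z + s * (snd u \<bullet> snd z)))" for s
  define \<xi> where "\<xi> = x \<bullet> snd u"
  have "((\<lambda>s. 2 * m / N s) has_real_derivative - (2 * m * (\<xi> / r)) / (N 0 * N 0)) (at 0)"
    using r N0 by (auto intro!: derivative_eq_intros N simp: \<xi>_def)
  then have D1: "((\<lambda>s. 2 * m / N s) has_real_derivative - (2 * m / r ^ 3) * \<xi>) (at 0)"
    by (simp add: N0 power3_eq_cube mult.assoc)
  have "((\<lambda>s. 2 * m / ((N s)\<^sup>2 * (N s - 2 * m))) has_real_derivative
      - (2 * m * (2 * N 0 * (\<xi> / r) * (N 0 - 2 * m) + (N 0)\<^sup>2 * (\<xi> / r))) / ((N 0)\<^sup>2 * (N 0 - 2 * m))\<^sup>2) (at 0)"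
    using r N0 by (auto intro!: derivative_eq_intros N simp: \<xi>_def power2_eq_square)
  moreover have "- (2 * m * (2 * r * (\<xi> / r) * (r - 2 * m) + r\<^sup>2 * (\<xi> / r))) / (r\<^sup>2 * (r - 2 * m))\<^sup>2
      = - (2 * m * (3 * r - 2 * (2 * m)) / (r ^ 4 * (r - 2 * m)\<^sup>2)) * \<xi>"
    using r by (simp add: power_mult_distrib power2_eq_square power4_eq_xxxx) (simp add: algebra_simps)
  ultimately have D2: "((\<lambda>s. 2 * m / ((N s)\<^sup>2 * (N s - 2 * m))) has_real_derivative
      - (2 * m * (3 * r - 2 * (2 * m)) / (r ^ 4 * (r - 2 * m)\<^sup>2)) * \<xi>) (at 0)"
    by (simp only: N0)
  have D3: "((\<lambda>s. c + s * d) has_real_derivative d) (at 0)" for c d :: real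
    by (auto intro!: derivative_eq_intros)
  have h: "(h has_real_derivative ?D) (at 0)"
    unfolding h_def[abs_def] \<xi>_def[symmetric]
    by (rule derivative_eq_intros D1 D2 D3 refl)+ (simp add: N0 algebra_simps)
  have "\<forall>\<^sub>F s in nhds 0. 2 * m < N s"
  proof -
    have "isCont N 0" using N by (rule DERIV_isCont)
    then have "(N \<longlongrightarrow> N 0) (nhds 0)" by (simp add: isCont_def tendsto_at_iff_tendsto_nhds)
    then show ?thesis by (rule order_tendstoD(1)) (use r N0 in simp)
  qed
  then have "\<forall>\<^sub>F s in nhds 0. schwarzschild_metric m (p + s *\<^sub>R u) v z = h s"
  proof eventually_elim
    case (elim s)
    then have "2 * m < norm (snd (p + s *\<^sub>R u))" by (simp add: N_def x_def)
    from schwarzschild_metric_eq[OF this m] show ?case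
      by (simp add: h_def N_def x_def inner_add_left)
  qed
  then show "((\<lambda>s. schwarzschild_metric m (p + s *\<^sub>R u) v z) has_real_derivative ?D) (at 0)"
    using h by (subst DERIV_cong_ev[OF refl _ refl])
qed

text \<open>Uniqueness in the Koszul formula reduces the claim to checking the stated vector against
  every test vector. \<rho> is the radial velocity.\<close>

lemma christoffel_schwarzschild:
  fixes m :: real and p v :: "real \<times> (real ^ 3)"
  assumes m: "m > 0" and p: "p \<in> schwarzschild_spacetime m"
  defines "x \<equiv> snd p" and "r \<equiv> norm (snd p)"
  defines "\<rho> \<equiv> (x \<bullet> snd v) / r"
  shows "christoffel (schwarzschild_metric m) p v v =
    (2 * m / (r * (r - 2 * m)) * (fst v * \<rho>),
     (2 * m / r ^ 3 * ((1 - 2 * m / r) * (fst v)\<^sup>2 / 2 - r / (r - 2 * m) * \<rho>\<^sup>2 / 2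
        + snd v \<bullet> snd v - \<rho>\<^sup>2)) *\<^sub>R x)" (is "_ = ?W")
  unfolding christoffel_def
proof (rule the1_equality[OF schwarzschild_christoffel_ex1[OF m p]], rule allI)
  fix z :: "real \<times> (real ^ 3)"
  have r: "r > 2 * m" "r > 0" "x \<noteq> 0" using p m by (auto simp: r_def x_def schwarzschild_spacetime_def)
  have xx: "x \<bullet> x = r\<^sup>2" by (simp add: r_def x_def dot_square_norm)
  have al: "x \<bullet> snd v = r * \<rho>" using r by (simp add: \<rho>_def)
  have c: "snd z \<bullet> snd v = snd v \<bullet> snd z" by (rule inner_commute)
  \<comment> \<open>With s = r - 2m and 2m = r - s every denominator is a product of powers of the
    positive quantities r and s.\<close>
  define s q \<zeta> y \<tau> where "s = r - 2 * m" and "q = snd v \<bullet> snd v" and "\<zeta> = x \<bullet> snd z"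
    and "y = snd v \<bullet> snd z" and "\<tau> = fst v"
  define \<sigma> where "\<sigma> = fst z"
  have s: "s > 0" "2 * m = r - s" using r by (auto simp: s_def)
  have p2: "2 * m < norm (snd p)" using r by (simp add: r_def)
  have rs: "r - (r - s) = s" by simp
  have nx: "norm x = r" by (simp add: r_def x_def)
  \<comment> \<open>Collects the three Koszul terms for arbitrary coefficients, leaving only the
    rational identity \<open>eq\<close> to check.\<close>
  have gen: "L = (- k1 * \<alpha> * (\<tau> * \<sigma>) - k2 * \<alpha> * (\<alpha> * \<zeta>) + k3 * (q * \<zeta> + \<alpha> * y)
      + (- k1 * \<alpha> * (\<tau> * \<sigma>) - k2 * \<alpha> * (\<alpha> * \<zeta>) + k3 * (q * \<zeta> + \<alpha> * y))
      - (- k1 * \<zeta> * (\<tau> * \<tau>) - k2 * \<zeta> * (\<alpha> * \<alpha>) + k3 * (y * \<alpha> + \<alpha> * y))) / 2"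
    if "L = - k1 * \<alpha> * (\<tau> * \<sigma>) + k1 * \<zeta> * (\<tau> * \<tau>) / 2 - k2 * \<alpha> * (\<alpha> * \<zeta>) / 2 + k3 * q * \<zeta>"
    for L k1 k2 k3 \<alpha> :: real
    unfolding that by (simp add: algebra_simps)
  have eq: "- (1 - (r - s) / r) * ((r - s) / (r * s) * (\<tau> * \<rho>) * \<sigma>)
      + (r - s) / r ^ 3 * ((1 - (r - s) / r) * \<tau>\<^sup>2 / 2 - r / s * \<rho>\<^sup>2 / 2 + q - \<rho>\<^sup>2) * \<zeta>
      + (r - s) / (r\<^sup>2 * s) * ((r - s) / r ^ 3 * ((1 - (r - s) / r) * \<tau>\<^sup>2 / 2 - r / s * \<rho>\<^sup>2 / 2 + q - \<rho>\<^sup>2) * r\<^sup>2 * \<zeta>)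
    = - ((r - s) / r ^ 3) * (r * \<rho>) * (\<tau> * \<sigma>) + (r - s) / r ^ 3 * \<zeta> * (\<tau> * \<tau>) / 2
      - (r - s) * (3 * r - 2 * (r - s)) / (r ^ 4 * s\<^sup>2) * (r * \<rho>) * ((r * \<rho>) * \<zeta>) / 2
      + (r - s) / (r\<^sup>2 * s) * q * \<zeta>"
    using r(2) s(1) by (simp add: field_simps power2_eq_square power3_eq_cube power4_eq_xxxx)
  show "schwarzschild_metric m p ?W z = (metric_deriv (schwarzschild_metric m) p v v z
    + metric_deriv (schwarzschild_metric m) p v v z - metric_deriv (schwarzschild_metric m) p z v v) / 2"
    unfolding schwarzschild_metric_eq[OF p2 m] metric_deriv_schwarzschild[OF m p]
      x_def[symmetric] nx fst_conv snd_conv inner_scaleR_left inner_scaleR_right xx al c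
      q_def[symmetric] \<zeta>_def[symmetric] y_def[symmetric] \<tau>_def[symmetric] \<sigma>_def[symmetric] 
    unfolding s(2) rs by (rule gen[OF eq])
qed

text \<open>The affine parameter satisfies dx/ds = K u^2, that is, r^2 dphi/ds is constant:
  conservation of angular momentum. \<open>K\<close> normalises the parameter interval to [0,1];
  \<open>n\<close> and \<open>k\<close> are the radial and tangential unit vectors.\<close>

lemma geodesic_of_orbit:
  fixes m w A E t0 :: real and u v :: "real \<Rightarrow> real" and e1 e2 :: "real ^ 3"
  assumes m: "m > 0" and e: "norm e1 = 1" "norm e2 = 1" "e1 \<bullet> e2 = 0"
    and u: "\<And>x. x \<in> {0..1} \<Longrightarrow> (u has_real_derivative v x) (at x within {0..1})"
    and v: "\<And>x. x \<in> {0..1} \<Longrightarrow>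
      (v has_real_derivative A - w\<^sup>2 * u x + 3 / 2 * w\<^sup>2 * (u x)\<^sup>2) (at x within {0..1})"
    and range: "\<And>x. x \<in> {0..1} \<Longrightarrow> 0 < u x \<and> u x < 1"
    and energy: "\<And>x. x \<in> {0..1} \<Longrightarrow> (v x)\<^sup>2 + (1 - u x) * (2 * A + w\<^sup>2 * (u x)\<^sup>2) = E\<^sup>2"
  obtains \<gamma> where "geodesic_on (schwarzschild_metric m) (schwarzschild_spacetime m) {0..1} \<gamma>"
    and "\<gamma> 0 = (t0, (2 * m / u 0) *\<^sub>R e1)"
    and "\<gamma> 1 = (t0 + 2 * m * (E * integral {0..1} (\<lambda>x. 1 / ((u x)\<^sup>2 * (1 - u x)))),
      (2 * m / u 1) *\<^sub>R (cos w *\<^sub>R e1 + sin w *\<^sub>R e2))"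
proof -
  define R where "R = 2 * m"
  have R: "R > 0" using m by (simp add: R_def)
  have contu: "continuous_on {0..1} u" by (rule DERIV_continuous_on[OF u])
  have contf: "continuous_on {0..1} (\<lambda>x. 1 / (u x)\<^sup>2)"
    by (intro continuous_intros contu) (use range in force)
  have fpos: "0 < 1 / (u x)\<^sup>2" if "x \<in> {0..1}" for x using range[OF that] by simp
  obtain l where l01: "l 0 = 0" "l 1 = 1" and l: "\<And>s. s \<in> {0..1} \<Longrightarrow> l s \<in> {0..1}"
    and l': "\<And>s. s \<in> {0..1} \<Longrightarrow>
      (l has_real_derivative integral {0..1} (\<lambda>x. 1 / (u x)\<^sup>2) / (1 / (u (l s))\<^sup>2)) (at s within {0..1})"
    by (rule ex_reparametrization[OF contf fpos]) (assumption | rule that; assumption)+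
  define K where "K = integral {0..1} (\<lambda>x. 1 / (u x)\<^sup>2)"
  have dl: "(l has_real_derivative K * (u (l s))\<^sup>2) (at s within {0..1})" if "s \<in> {0..1}" for s
    using l'[OF that] by (simp add: K_def)
  have chain: "((\<lambda>s. f (l s)) has_real_derivative D * (K * (u (l s))\<^sup>2)) (at s within {0..1})"
    if "s \<in> {0..1}" "(f has_real_derivative D) (at (l s) within {0..1})" for s D f
    using DERIV_image_chain[OF DERIV_subset[OF that(2)] dl[OF that(1)]] l by (simp add: o_def image_subset_iff)
  define h where "h x = 1 / ((u x)\<^sup>2 * (1 - u x))" for x
  have conth: "continuous_on {0..1} h"
    unfolding h_def by (intro continuous_intros contu) (use range in force)
  define n where "n s = cos (w * l s) *\<^sub>R e1 + sin (w * l s) *\<^sub>R e2" for s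
  define k where "k s = - sin (w * l s) *\<^sub>R e1 + cos (w * l s) *\<^sub>R e2" for s
  have ee: "e1 \<bullet> e1 = 1" "e2 \<bullet> e2 = 1" "e1 \<bullet> e2 = 0" "e2 \<bullet> e1 = 0"
    using e by (simp_all add: dot_square_norm inner_commute)
  have nk: "n s \<bullet> n s = 1" "k s \<bullet> k s = 1" "n s \<bullet> k s = 0" "k s \<bullet> n s = 0" for s
    by (simp_all add: n_def k_def inner_add_left inner_add_right inner_diff_left inner_diff_right ee
        flip: power2_eq_square)
  have norm_n: "norm (n s) = 1" for s by (simp add: norm_eq_sqrt_inner nk)
  define \<tau> where "\<tau> s = t0 + R * E * integral {0..l s} h" for s
  define \<gamma> where "\<gamma> s = (\<tau> s, (R / u (l s)) *\<^sub>R n s)" for s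
  define \<gamma>' where "\<gamma>' s = (R * K * E / (1 - u (l s)), - (R * K * v (l s)) *\<^sub>R n s + (R * w * K * u (l s)) *\<^sub>R k s)" for s
  have in_M: "\<gamma> s \<in> schwarzschild_spacetime m" if s: "s \<in> {0..1}" for s
    using range[OF l[OF s]] R by (simp add: schwarzschild_spacetime_def \<gamma>_def norm_n R_def field_simps)
  have deriv: "(\<gamma> has_vector_derivative \<gamma>' s) (at s within {0..1}) \<and>
    (\<gamma>' has_vector_derivative - christoffel (schwarzschild_metric m) (\<gamma> s) (\<gamma>' s) (\<gamma>' s)) (at s within {0..1})"
    if s: "s \<in> {0..1}" for s
  proof -
    define U V where "U = u (l s)" and "V = v (l s)"
    define F where "F = A - w\<^sup>2 * U + 3 / 2 * w\<^sup>2 * U\<^sup>2"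
    have U: "0 < U" "U < 1" using range[OF l[OF s]] by (auto simp: U_def)
    have en: "E\<^sup>2 = V\<^sup>2 + (1 - U) * (2 * A + w\<^sup>2 * U\<^sup>2)" using energy[OF l[OF s]] by (simp add: U_def V_def)
    note dU = chain[OF s u[OF l[OF s]], folded U_def V_def]
    note dV = chain[OF s v[OF l[OF s]], folded U_def V_def, folded F_def]
    have dl': "(l has_real_derivative K * U\<^sup>2) (at s within {0..1})" using dl[OF s] by (simp add: U_def)
    have dcos: "((\<lambda>s. cos (w * l s)) has_real_derivative - (w * K * U\<^sup>2) * sin (w * l s)) (at s within {0..1})"
      and dsin: "((\<lambda>s. sin (w * l s)) has_real_derivative (w * K * U\<^sup>2) * cos (w * l s)) (at s within {0..1})"
      by (auto intro!: derivative_eq_intros dl')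
    have dn: "(n has_vector_derivative (w * K * U\<^sup>2) *\<^sub>R k s) (at s within {0..1})"
      unfolding n_def[abs_def]
      by (rule has_vector_derivative_eq_rhs[OF has_vector_derivative_add[OF
            has_vector_derivative_scaleR[OF dcos has_vector_derivative_const]
            has_vector_derivative_scaleR[OF dsin has_vector_derivative_const]]])
        (simp add: k_def scaleR_diff_right)
    have dk: "(k has_vector_derivative - (w * K * U\<^sup>2) *\<^sub>R n s) (at s within {0..1})"
      unfolding k_def[abs_def]
      by (rule has_vector_derivative_eq_rhs[OF has_vector_derivative_add[OF
            has_vector_derivative_scaleR[OF DERIV_minus[OF dsin] has_vector_derivative_const]
            has_vector_derivative_scaleR[OF dcos has_vector_derivative_const]]])
        (simp add: n_def scaleR_add_right)
    have d\<tau>: "(\<tau> has_real_derivative R * K * E / (1 - U)) (at s within {0..1})"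
    proof -
      have "((\<lambda>s. integral {0..l s} h) has_real_derivative h (l s) * (K * (u (l s))\<^sup>2)) (at s within {0..1})"
        by (rule chain[OF s integral_has_real_derivative[OF conth l[OF s]]])
      moreover have "h (l s) * (K * (u (l s))\<^sup>2) = K / (1 - U)"
        using U by (simp add: h_def U_def[symmetric])
      ultimately show ?thesis
        unfolding \<tau>_def[abs_def] by (auto intro!: derivative_eq_intros)
    qed
    have dr: "((\<lambda>s. R / u (l s)) has_real_derivative - (R * K * V)) (at s within {0..1})"
      by (rule derivative_eq_intros dU refl)+ (use U in \<open>simp_all add: U_def[symmetric] power2_eq_square\<close>)
    have "(\<gamma> has_vector_derivative (R * K * E / (1 - U),
        (R / U) *\<^sub>R ((w * K * U\<^sup>2) *\<^sub>R k s) + - (R * K * V) *\<^sub>R n s)) (at s within {0..1})"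
      unfolding \<gamma>_def[abs_def] U_def
      using has_vector_derivative_Pair[OF d\<tau>[unfolded has_real_derivative_iff_has_vector_derivative]
          has_vector_derivative_scaleR[OF dr dn]]
      by (simp only: U_def)
    moreover have "(R * K * E / (1 - U), (R / U) *\<^sub>R ((w * K * U\<^sup>2) *\<^sub>R k s) + - (R * K * V) *\<^sub>R n s) = \<gamma>' s"
      using U by (simp add: \<gamma>'_def U_def[symmetric] V_def[symmetric] power2_eq_square mult_ac)
    ultimately have 1: "(\<gamma> has_vector_derivative \<gamma>' s) (at s within {0..1})" by simp
    have dT: "((\<lambda>s. R * K * E / (1 - u (l s))) has_real_derivative R * K\<^sup>2 * E * U\<^sup>2 * V / (1 - U)\<^sup>2) (at s within {0..1})"
      by (rule derivative_eq_intros dU refl)+ (use U in \<open>simp_all add: U_def[symmetric] power2_eq_square\<close>)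
    have da: "((\<lambda>s. - (R * K * v (l s))) has_real_derivative - (R * K\<^sup>2 * U\<^sup>2 * F)) (at s within {0..1})"
      by (rule derivative_eq_intros dV refl)+ (simp add: power2_eq_square)
    have db: "((\<lambda>s. R * w * K * u (l s)) has_real_derivative R * w * K\<^sup>2 * U\<^sup>2 * V) (at s within {0..1})"
      by (rule derivative_eq_intros dU refl)+ (simp add: power2_eq_square)
    \<comment> \<open>The tangential parts of the acceleration cancel, by the choice of the
      parameter.\<close>
    define acc where "acc = (R * K\<^sup>2 * E * U\<^sup>2 * V / (1 - U)\<^sup>2, - (R * K\<^sup>2 * U\<^sup>2 * (F + w\<^sup>2 * U)) *\<^sub>R n s)"
    have "(\<gamma>' has_vector_derivative (R * K\<^sup>2 * E * U\<^sup>2 * V / (1 - U)\<^sup>2,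
       (- (R * K * V) *\<^sub>R ((w * K * U\<^sup>2) *\<^sub>R k s) + - (R * K\<^sup>2 * U\<^sup>2 * F) *\<^sub>R n s)
       + ((R * w * K * U) *\<^sub>R (- (w * K * U\<^sup>2) *\<^sub>R n s) + (R * w * K\<^sup>2 * U\<^sup>2 * V) *\<^sub>R k s))) (at s within {0..1})"
      unfolding \<gamma>'_def[abs_def]
      using has_vector_derivative_Pair[OF dT[unfolded has_real_derivative_iff_has_vector_derivative]
          has_vector_derivative_add[OF has_vector_derivative_scaleR[OF da dn] has_vector_derivative_scaleR[OF db dk]]]
      by (simp only: U_def V_def)
    moreover have "(- (R * K * V) *\<^sub>R ((w * K * U\<^sup>2) *\<^sub>R k s) + - (R * K\<^sup>2 * U\<^sup>2 * F) *\<^sub>R n s)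
       + ((R * w * K * U) *\<^sub>R (- (w * K * U\<^sup>2) *\<^sub>R n s) + (R * w * K\<^sup>2 * U\<^sup>2 * V) *\<^sub>R k s)
       = - (R * K\<^sup>2 * U\<^sup>2 * (F + w\<^sup>2 * U)) *\<^sub>R n s"
      by (simp add: algebra_simps power2_eq_square)
    ultimately have 2: "(\<gamma>' has_vector_derivative acc) (at s within {0..1})"
      by (simp add: acc_def)
    define r where "r = R / U"
    have r: "norm (snd (\<gamma> s)) = r" using U R by (simp add: \<gamma>_def norm_n r_def U_def[symmetric])
    have \<rho>: "snd (\<gamma> s) \<bullet> snd (\<gamma>' s) / r = - (R * K * V)"
      using U R by (simp add: \<gamma>_def \<gamma>'_def inner_add_right inner_diff_right nk r_def U_def[symmetric] V_def[symmetric])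
    have vv: "snd (\<gamma>' s) \<bullet> snd (\<gamma>' s) = (R * K * V)\<^sup>2 + (R * w * K * U)\<^sup>2"
      by (simp add: \<gamma>'_def inner_add_right inner_add_left inner_diff_left inner_diff_right nk U_def[symmetric] V_def[symmetric] flip: power2_eq_square)
    have f: "fst (\<gamma>' s) = R * K * E / (1 - U)" by (simp add: \<gamma>'_def U_def)
    have sn: "snd (\<gamma> s) = r *\<^sub>R n s" by (simp add: \<gamma>_def r_def U_def)
    have t_comp: "R / (r * (r - R)) * (R * K * E / (1 - U) * - (R * K * V)) = - (R * K\<^sup>2 * E * U\<^sup>2 * V / (1 - U)\<^sup>2)"
    proof -
      have "r * (r - R) = R\<^sup>2 * (1 - U) / U\<^sup>2" using U by (simp add: r_def field_simps power2_eq_square)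
      then show ?thesis using U R by (simp add: power2_eq_square)
    qed
    have x_comp: "R / r ^ 3 * ((1 - R / r) * (R * K * E / (1 - U))\<^sup>2 / 2 - r / (r - R) * (- (R * K * V))\<^sup>2 / 2
        + ((R * K * V)\<^sup>2 + (R * w * K * U)\<^sup>2) - (- (R * K * V))\<^sup>2) * r = R * K\<^sup>2 * U\<^sup>2 * (F + w\<^sup>2 * U)"
    proof -
      have a1: "1 - R / r = 1 - U" using U R by (simp add: r_def)
      have "r - R = R * (1 - U) / U" using U by (simp add: r_def field_simps)
      then have a2: "r / (r - R) = 1 / (1 - U)" using U R by (simp add: r_def)
      have a3: "R / r ^ 3 * X * r = U\<^sup>2 / R * X" for X
        using U R by (simp add: r_def power2_eq_square power3_eq_cube)
      have "q * (R * K * E / q)\<^sup>2 / 2 - 1 / q * (- (R * K * V))\<^sup>2 / 2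
        = R\<^sup>2 * K\<^sup>2 * (E\<^sup>2 - V\<^sup>2) / (2 * q)" if "q > 0" for q
        using that by (simp add: power2_eq_square field_simps)
      from this[of "1 - U"] have "(1 - U) * (R * K * E / (1 - U))\<^sup>2 / 2 - 1 / (1 - U) * (- (R * K * V))\<^sup>2 / 2
        = R\<^sup>2 * K\<^sup>2 * (E\<^sup>2 - V\<^sup>2) / (2 * (1 - U))"
        using U(2) unfolding diff_gt_0_iff_gt by blast
      \<comment> \<open>Energy conservation removes E and V, and with them the denominator 1 -
        U.\<close>
      also have "\<dots> = R\<^sup>2 * K\<^sup>2 * (2 * A + w\<^sup>2 * U\<^sup>2) / 2"
      proof -
        have cancel: "c * (q * X) / (2 * q) = c * X / 2" if "0 < q" for c q X :: real using that by simp
        have "E\<^sup>2 - V\<^sup>2 = (1 - U) * (2 * A + w\<^sup>2 * U\<^sup>2)" using en by simp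
        then show ?thesis using cancel[of "1 - U"] U(2) by (simp only: diff_gt_0_iff_gt)
      qed
      finally have a4: "(1 - U) * (R * K * E / (1 - U))\<^sup>2 / 2 - 1 / (1 - U) * (- (R * K * V))\<^sup>2 / 2
        = R\<^sup>2 * K\<^sup>2 * (2 * A + w\<^sup>2 * U\<^sup>2) / 2" .
      \<comment> \<open>What remains is F + w^2 U = A + 3/2 w^2 U^2, the orbit equation.\<close>
      show ?thesis
        unfolding a1 a2 a3 a4 using R by (simp add: F_def power2_eq_square field_simps)
    qed
    have "christoffel (schwarzschild_metric m) (\<gamma> s) (\<gamma>' s) (\<gamma>' s) = - acc"
      unfolding christoffel_schwarzschild[OF m in_M[OF s]] r \<rho> vv f R_def[symmetric] t_comp
      unfolding sn scaleR_scaleR x_comp by (simp add: acc_def)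
    with 1 2 show ?thesis by simp
  qed
  show ?thesis
  proof (rule that[of \<gamma>])
    show "geodesic_on (schwarzschild_metric m) (schwarzschild_spacetime m) {0..1} \<gamma>"
      unfolding geodesic_on_def using in_M deriv by blast
    show "\<gamma> 0 = (t0, (2 * m / u 0) *\<^sub>R e1)"
      by (simp add: \<gamma>_def \<tau>_def n_def l01 R_def)
    show "\<gamma> 1 = (t0 + 2 * m * (E * integral {0..1} (\<lambda>x. 1 / ((u x)\<^sup>2 * (1 - u x)))),
      (2 * m / u 1) *\<^sub>R (cos w *\<^sub>R e1 + sin w *\<^sub>R e2))"
      by (simp add: \<gamma>_def \<tau>_def n_def l01 R_def h_def[abs_def])
  qed
qed

text \<open>Gram-Schmidt. When x and y are collinear the second vector is any unit vector orthogonal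
  to x, which is where dimension at least 2 is needed. The angle is an arccos, whence w <=
  pi.\<close>

lemma ex_polar_frame:
  fixes x y :: "'a::euclidean_space"
  assumes "2 \<le> DIM('a)" and x: "x \<noteq> 0" and y: "y \<noteq> 0"
  obtains e1 e2 :: 'a and w where "norm e1 = 1" "norm e2 = 1" "e1 \<bullet> e2 = 0" "0 \<le> w" "w \<le> pi"
    "x = norm x *\<^sub>R e1" "y = norm y *\<^sub>R (cos w *\<^sub>R e1 + sin w *\<^sub>R e2)"
proof -
  define e1 where "e1 = x /\<^sub>R norm x"
  define n where "n = y /\<^sub>R norm y"
  define c where "c = e1 \<bullet> n"
  have e1: "norm e1 = 1" "x = norm x *\<^sub>R e1" and n: "norm n = 1" "y = norm y *\<^sub>R n"
    using x y by (auto simp: e1_def n_def)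
  have dots: "e1 \<bullet> e1 = 1" "n \<bullet> n = 1" using e1 n by (simp_all add: dot_square_norm)
  have c: "- 1 \<le> c" "c \<le> 1"
    using Cauchy_Schwarz_ineq2[of e1 n] e1 n by (auto simp: c_def)
  define z where "z = n - c *\<^sub>R e1"
  have z: "e1 \<bullet> z = 0" "z \<bullet> z = 1 - c\<^sup>2"
    using dots by (simp_all add: z_def inner_diff_left inner_diff_right c_def[symmetric] inner_commute[of n e1] power2_eq_square)
  have nz: "norm z = sin (arccos c)"
    using z(2) c by (simp add: norm_eq_sqrt_inner sin_arccos)
  have w: "0 \<le> arccos c" "arccos c \<le> pi" "cos (arccos c) = c"
    using c by (auto intro: arccos_lbound arccos_ubound)
  have "\<exists>e2. norm e2 = 1 \<and> e1 \<bullet> e2 = 0 \<and> norm z *\<^sub>R e2 = z"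
  proof (cases "z = 0")
    case True
    obtain u where "u \<noteq> 0" "orthogonal e1 u" using orthogonal_to_vector_exists assms(1) by blast
    then show ?thesis using True
      by (intro exI[of _ "u /\<^sub>R norm u"]) (auto simp: orthogonal_def)
  next
    case False
    then show ?thesis using z by (intro exI[of _ "z /\<^sub>R norm z"]) auto
  qed
  then obtain e2 where e2: "norm e2 = 1" "e1 \<bullet> e2 = 0" "norm z *\<^sub>R e2 = z" by blast
  have "n = cos (arccos c) *\<^sub>R e1 + sin (arccos c) *\<^sub>R e2"
    unfolding nz[symmetric] e2(3) w(3) by (simp add: z_def)
  then show ?thesis using that[of e1 e2 "arccos c"] e1 e2 n w by metis
qed

theorem theorem6:
  fixes m :: real
  assumes "m > 0"
  shows "geodesically_connected (schwarzschild_metric m) (schwarzschild_spacetime m)"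
  unfolding geodesically_connected_def
proof (intro ballI)
  fix p q :: "real \<times> (real ^ 3)"
  assume p: "p \<in> schwarzschild_spacetime m" and q: "q \<in> schwarzschild_spacetime m"
  define t0 x0 t1 x1 where "t0 = fst p" and "x0 = snd p" and "t1 = fst q" and "x1 = snd q"
  have r: "2 * m < norm x0" "2 * m < norm x1"
    using p q by (auto simp: schwarzschild_spacetime_def x0_def x1_def)
  then have nz: "x0 \<noteq> 0" "x1 \<noteq> 0" using assms by auto
  have dim: "2 \<le> DIM(real ^ 3)" by simp
  obtain e1 e2 :: "real ^ 3" and w where e: "norm e1 = 1" "norm e2 = 1" "e1 \<bullet> e2 = 0"
    and w: "0 \<le> w" "w \<le> pi" and x0: "x0 = norm x0 *\<^sub>R e1"
    and x1: "x1 = norm x1 *\<^sub>R (cos w *\<^sub>R e1 + sin w *\<^sub>R e2)"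
    by (rule ex_polar_frame[OF dim nz]) (rule that; assumption)
  have bounds: "0 < 2 * m / norm x0" "2 * m / norm x0 < 1" "0 < 2 * m / norm x1" "2 * m / norm x1 < 1"
    using r assms nz by auto
  obtain A E :: real and u v :: "real \<Rightarrow> real" where
    u: "\<And>x. x \<in> {0..1} \<Longrightarrow> (u has_real_derivative v x) (at x within {0..1})"
    and v: "\<And>x. x \<in> {0..1} \<Longrightarrow>
      (v has_real_derivative A - w\<^sup>2 * u x + 3 / 2 * w\<^sup>2 * (u x)\<^sup>2) (at x within {0..1})"
    and range: "\<And>x. x \<in> {0..1} \<Longrightarrow> 0 < u x \<and> u x < 1"
    and ends: "u 0 = 2 * m / norm x0" "u 1 = 2 * m / norm x1"
    and energy: "\<And>x. x \<in> {0..1} \<Longrightarrow> (v x)\<^sup>2 + (1 - u x) * (2 * A + w\<^sup>2 * (u x)\<^sup>2) = E\<^sup>2"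
    and T: "E * integral {0..1} (\<lambda>x. 1 / ((u x)\<^sup>2 * (1 - u x))) = (t1 - t0) / (2 * m)"
    by (rule ex_orbit[OF w bounds]) (rule that; assumption)
  obtain \<gamma> where \<gamma>: "geodesic_on (schwarzschild_metric m) (schwarzschild_spacetime m) {0..1} \<gamma>"
    and \<gamma>0: "\<gamma> 0 = (t0, (2 * m / u 0) *\<^sub>R e1)"
    and \<gamma>1: "\<gamma> 1 = (t0 + 2 * m * (E * integral {0..1} (\<lambda>x. 1 / ((u x)\<^sup>2 * (1 - u x)))),
      (2 * m / u 1) *\<^sub>R (cos w *\<^sub>R e1 + sin w *\<^sub>R e2))"
    by (rule geodesic_of_orbit[OF assms e u v range energy, where ?t0.0 = t0]) (assumption | rule that; assumption)+
  have "2 * m / u 0 = norm x0" "2 * m / u 1 = norm x1" using assms by (auto simp: ends)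
  then have "\<gamma> 0 = p" "\<gamma> 1 = q"
    unfolding \<gamma>0 \<gamma>1 T using x0 x1 assms by (simp_all add: t0_def t1_def x0_def x1_def prod_eq_iff)
  with \<gamma> show "\<exists>\<gamma>. geodesic_on (schwarzschild_metric m) (schwarzschild_spacetime m) {0..1} \<gamma> \<and> \<gamma> 0 = p \<and> \<gamma> 1 = q"
    by blast
qed

end
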